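(* Let $Q:\mathbb{C}\to\mathbb{R}$ be $C^2$-smooth and satisfy $Q(z)\ge(1+\epsilon)\log|z|^2$ for $|z|\ge C_0$, for some positive numbers $\epsilon,C_0$. Then there exists a constant $C$, depending only on $Q$, such that for all $z,w\in\mathbb{C}$, all real $m\ge1$ and all positive integers $n\le m$, $$|K_{2,mQ,n}(w,z)|^2\,e^{-mQ(w)-mQ(z)}\le C^2\,m^4\,e^{-m(Q(z)-\widehat Q(z))}\,e^{-m(Q(w)-\widehat Q(w))}.$$
   Context: Notation: $dA(z)=\pi^{-1}\,dx\,dy$. $L^2(e^{-mQ})$ is the space of measurable functions on $\mathbb{C}$ that are square-integrable with respect to $e^{-mQ}\,dA$. For an integer $n\ge1$ and real $m>0$, $\mathrm{Pol}_{2,n}=\operatorname{span}_{\mathbb{C}}\{\bar z^r z^j: 0\le r\le 1,\ 0\le j\le n-1\}$ and $A^2_{2,mQ,n}=\mathrm{Pol}_{2,n}\cap L^2(e^{-mQ})$, a finite-dimensional subspace of $L^2(e^{-mQ})$. $K_{2,mQ,n}$ is its reproducing kernel: $K_{2,mQ,n}(z,w)=\sum_j e_j(z)\overline{e_j(w)}$ for any orthonormal basis $(e_j)$ of $A^2_{2,mQ,n}$. The equilibrium weight $\widehat Q$ is the largest subharmonic function on $\mathbb{C}$ that is $\le Q$ everywhere and satisfies $\widehat Q(z)=\log|z|^2+O(1)$ as $|z|\to\infty$. *)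

theory Defs
  imports "HOL-Analysis.Analysis"
begin

section \<open>Smooth weights\<close>

text \<open>The first and second (real) Frechet derivatives exist everywhere and the second one is
  continuous in the operator norm.\<close>

definition C2_smooth :: "(complex \<Rightarrow> real) \<Rightarrow> bool" where
  "C2_smooth Q \<longleftrightarrow>
    (\<exists>(Q' :: complex \<Rightarrow> (complex \<Rightarrow>\<^sub>L real)) (Q'' :: complex \<Rightarrow> (complex \<Rightarrow>\<^sub>L (complex \<Rightarrow>\<^sub>L real))).
      (\<forall>z. (Q has_derivative blinfun_apply (Q' z)) (at z)) \<and>
      (\<forall>z. (Q' has_derivative blinfun_apply (Q'' z)) (at z)) \<and>
      continuous_on UNIV Q'')"

section \<open>Subharmonic functions and the equilibrium weight\<close>

text \<open>The integral of an extended real function, \<open>\<integral>f\<^sup>+ - \<integral>f\<^sup>-\<close>; recall that \<open>e2ennreal\<close> sends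
  negative arguments to 0.  It is only used for functions bounded above on spaces of finite
  measure, where the first term is finite, so that the difference is the usual one
  (possibly \<open>-\<infinity>\<close>).\<close>

definition ereal_integral :: "'a measure \<Rightarrow> ('a \<Rightarrow> ereal) \<Rightarrow> ereal" where
  "ereal_integral M f =
    enn2ereal (\<integral>\<^sup>+x. e2ennreal (f x) \<partial>M) - enn2ereal (\<integral>\<^sup>+x. e2ennreal (- f x) \<partial>M)"

text \<open>The mean value over a circle of an upper semicontinuous function.\<close>

definition circle_mean :: "(complex \<Rightarrow> ereal) \<Rightarrow> complex \<Rightarrow> real \<Rightarrow> ereal" where
  "circle_mean u a r =
    ereal (1 / (2 * pi)) *
      ereal_integral (restrict_space lborel {0..2 * pi}) (\<lambda>t. u (a + of_real r * cis t))"

text \<open>Subharmonicity on all of the complex plane: values in \<open>[-\<infinity>, \<infinity>)\<close>, upper semicontinuity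
  and the sub-mean value property on every circle.\<close>

definition subharmonic :: "(complex \<Rightarrow> ereal) \<Rightarrow> bool" where
  "subharmonic u \<longleftrightarrow>
    (\<forall>z. u z < \<infinity>) \<and>
    (\<forall>c. open {z. u z < c}) \<and>
    (\<forall>a r. r > 0 \<longrightarrow> u a \<le> circle_mean u a r)"

text \<open>\<open>u z = log |z|\<^sup>2 + O(1)\<close> as \<open>|z| \<rightarrow> \<infinity>\<close>.\<close>

definition log_growth :: "(complex \<Rightarrow> ereal) \<Rightarrow> bool" where
  "log_growth u \<longleftrightarrow>
    (\<exists>B::real. \<forall>\<^sub>F z in at_infinity.
      ereal (ln ((norm z)\<^sup>2) - B) \<le> u z \<and> u z \<le> ereal (ln ((norm z)\<^sup>2) + B))"

text \<open>\<open>GREATEST\<close> refers to the pointwise order.  For the weights considered here the greatest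
  function has only finite values, so that the conversion to the reals loses nothing.\<close>

definition equilibrium_weight :: "(complex \<Rightarrow> real) \<Rightarrow> complex \<Rightarrow> real" where
  "equilibrium_weight Q z =
    real_of_ereal ((GREATEST u. subharmonic u \<and> (\<forall>z. u z \<le> ereal (Q z)) \<and> log_growth u) z)"

section \<open>Reproducing kernels\<close>

definition L2_space :: "'a measure \<Rightarrow> ('a \<Rightarrow> complex) set" where
  "L2_space M = {f \<in> borel_measurable M. integrable M (\<lambda>x. (norm (f x))\<^sup>2)}"

definition L2_inner :: "'a measure \<Rightarrow> ('a \<Rightarrow> complex) \<Rightarrow> ('a \<Rightarrow> complex) \<Rightarrow> complex" where
  "L2_inner M f g = (\<integral>x. f x * cnj (g x) \<partial>M)"

definition is_reproducing_kernel ::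
    "'a measure \<Rightarrow> ('a \<Rightarrow> complex) set \<Rightarrow> ('a \<Rightarrow> 'a \<Rightarrow> complex) \<Rightarrow> bool" where
  "is_reproducing_kernel M V K \<longleftrightarrow>
    (\<forall>w. (\<lambda>z. K z w) \<in> V) \<and> (\<forall>f\<in>V. \<forall>w. f w = L2_inner M f (\<lambda>z. K z w))"

definition reproducing_kernel ::
    "'a measure \<Rightarrow> ('a \<Rightarrow> complex) set \<Rightarrow> 'a \<Rightarrow> 'a \<Rightarrow> complex" where
  "reproducing_kernel M V = (THE K. is_reproducing_kernel M V K)"

lemma L2_inner_commute: "L2_inner M g f = cnj (L2_inner M f g)"
proof -
  have "L2_inner M g f = (\<integral>x. cnj (f x * cnj (g x)) \<partial>M)"
    unfolding L2_inner_def
    by (rule Bochner_Integration.integral_cong) (simp_all only: complex_cnj_mult complex_cnj_cnj mult.commute)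
  also have "\<dots> = cnj (L2_inner M f g)"
    unfolding L2_inner_def by (rule Bochner_Integration.integral_cnj)
  finally show ?thesis .
qed

lemma is_reproducing_kernel_unique:
  assumes K: "is_reproducing_kernel M V K" and L: "is_reproducing_kernel M V L"
  shows "K = L"
proof (intro ext)
  fix z w
  have rep: "H x y = L2_inner M (\<lambda>t. H t y) (\<lambda>t. G t x)"
    if "is_reproducing_kernel M V H" "is_reproducing_kernel M V G" for G H x y
  proof -
    have "(\<lambda>t. H t y) \<in> V"
      using that(1) by (simp add: is_reproducing_kernel_def)
    moreover have "\<forall>f\<in>V. \<forall>w. f w = L2_inner M f (\<lambda>t. G t w)"
      using that(2) by (simp add: is_reproducing_kernel_def)
    ultimately show ?thesis by simp
  qed
  have "K z w = L2_inner M (\<lambda>t. K t w) (\<lambda>t. L t z)" by (rule rep [OF K L])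
  also have "\<dots> = cnj (L2_inner M (\<lambda>t. L t z) (\<lambda>t. K t w))" by (rule L2_inner_commute)
  also have "\<dots> = cnj (L w z)" by (rule arg_cong [where f = cnj, OF rep [OF L K, symmetric]])
  also have "\<dots> = cnj (L2_inner M (\<lambda>t. L t z) (\<lambda>t. L t w))"
    by (rule arg_cong [where f = cnj, OF rep [OF L L]])
  also have "\<dots> = L2_inner M (\<lambda>t. L t w) (\<lambda>t. L t z)" by (rule L2_inner_commute [symmetric])
  also have "\<dots> = L z w" by (rule rep [OF L L, symmetric])
  finally show "K z w = L z w" .
qed

lemma L2_mult_integrable:
  assumes "f \<in> L2_space M" "g \<in> L2_space M"
  shows "integrable M (\<lambda>x. f x * cnj (g x))"
proof (rule Bochner_Integration.integrable_bound)
  show "integrable M (\<lambda>x. (norm (f x))\<^sup>2 + (norm (g x))\<^sup>2)"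
    using assms by (auto simp: L2_space_def)
  have cnj: "cnj \<in> borel_measurable borel"
    by (intro borel_measurable_continuous_onI continuous_intros)
  have "g \<in> borel_measurable M"
    using assms(2) by (simp add: L2_space_def)
  then have "(\<lambda>x. cnj (g x)) \<in> borel_measurable M"
    by (rule measurable_compose [OF _ cnj])
  then show "(\<lambda>x. f x * cnj (g x)) \<in> borel_measurable M"
    using assms(1) by (intro borel_measurable_times) (simp_all add: L2_space_def)
  have "a * b \<le> a\<^sup>2 + b\<^sup>2" if "a \<ge> 0" "b \<ge> 0" for a b :: real
    using sum_squares_bound [of a b] that mult_nonneg_nonneg [OF that] by linarith
  then show "AE x in M. norm (f x * cnj (g x)) \<le> norm ((norm (f x))\<^sup>2 + (norm (g x))\<^sup>2)"
    by (auto simp: norm_mult)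
qed

text \<open>The reproducing kernel is given by the usual formula in terms of any orthonormal basis.\<close>

lemma reproducing_kernel_orthonormal_basis:
  assumes "finite J" and L2: "V \<subseteq> L2_space M"
    and span: "V = {f. \<exists>c. f = (\<lambda>z. \<Sum>j\<in>J. c j * e j z)}"
    and on: "\<And>i j. i \<in> J \<Longrightarrow> j \<in> J \<Longrightarrow> L2_inner M (e i) (e j) = (if i = j then 1 else 0)"
  shows "reproducing_kernel M V = (\<lambda>z w. \<Sum>j\<in>J. e j z * cnj (e j w))"
proof -
  have eV: "e i \<in> L2_space M" if "i \<in> J" for i
  proof -
    have "e i = (\<lambda>z. \<Sum>j\<in>J. (if j = i then 1 else 0) * e j z)"
      using that \<open>finite J\<close> by (auto simp: if_distrib [of "\<lambda>x. x * _"] cong: if_cong)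
    then have "e i \<in> V" unfolding span
      by (intro CollectI exI [of _ "\<lambda>j. if j = i then 1 else 0"])
    then show ?thesis using L2 by blast
  qed
  have "is_reproducing_kernel M V (\<lambda>z w. \<Sum>j\<in>J. e j z * cnj (e j w))"
    unfolding is_reproducing_kernel_def
  proof (intro conjI allI ballI)
    fix w
    show "(\<lambda>z. \<Sum>j\<in>J. e j z * cnj (e j w)) \<in> V"
      unfolding span
      by (intro CollectI exI [of _ "\<lambda>j. cnj (e j w)"] ext sum.cong refl mult.commute)
  next
    fix f w assume "f \<in> V"
    then obtain c where f: "f = (\<lambda>z. \<Sum>j\<in>J. c j * e j z)" unfolding span by blast
    have "L2_inner M f (\<lambda>z. \<Sum>j\<in>J. e j z * cnj (e j w))
        = (\<integral>z. (\<Sum>i\<in>J. \<Sum>j\<in>J. (c i * e j w) * (e i z * cnj (e j z))) \<partial>M)"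
      unfolding L2_inner_def f
      by (intro Bochner_Integration.integral_cong refl) (simp add: sum_product algebra_simps)
    also have "\<dots> = (\<Sum>i\<in>J. \<Sum>j\<in>J. (c i * e j w) * L2_inner M (e i) (e j))"
      by (simp add: L2_inner_def L2_mult_integrable eV)
    also have "\<dots> = (\<Sum>i\<in>J. \<Sum>j\<in>J. if i = j then c i * e j w else 0)"
      by (intro sum.cong refl) (simp add: on)
    also have "\<dots> = f w"
      using \<open>finite J\<close> unfolding f by simp
    finally show "f w = L2_inner M f (\<lambda>z. \<Sum>j\<in>J. e j z * cnj (e j w))" ..
  qed
  then show ?thesis
    unfolding reproducing_kernel_def
    by (intro the_equality) (assumption, erule is_reproducing_kernel_unique)
qed

section \<open>Polyanalytic polynomial kernels\<close>

text \<open>The measure \<open>e\<^bsup>-mQ\<^esup> dA\<close>, where \<open>dA = dx dy / \<pi>\<close>.\<close>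

definition weighted_area :: "real \<Rightarrow> (complex \<Rightarrow> real) \<Rightarrow> complex measure" where
  "weighted_area m Q = density lborel (\<lambda>z. ennreal (exp (- m * Q z) / pi))"

definition Pol :: "nat \<Rightarrow> nat \<Rightarrow> (complex \<Rightarrow> complex) set" where
  "Pol q n = {f. \<exists>c. f = (\<lambda>z. \<Sum>r<q. \<Sum>j<n. c r j * (cnj z ^ r * z ^ j))}"

definition polyanalytic_space ::
    "nat \<Rightarrow> real \<Rightarrow> (complex \<Rightarrow> real) \<Rightarrow> nat \<Rightarrow> (complex \<Rightarrow> complex) set" where
  "polyanalytic_space q m Q n = Pol q n \<inter> L2_space (weighted_area m Q)"

definition polyanalytic_kernel ::
    "nat \<Rightarrow> real \<Rightarrow> (complex \<Rightarrow> real) \<Rightarrow> nat \<Rightarrow> complex \<Rightarrow> complex \<Rightarrow> complex" where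
  "polyanalytic_kernel q m Q n =
    reproducing_kernel (weighted_area m Q) (polyanalytic_space q m Q n)"

end

theory Submission
  imports Defs "HOL-Complex_Analysis.Complex_Analysis" "HOL-Computational_Algebra.Fundamental_Theorem_Algebra"
begin

text \<open>By duality it suffices to bound point evaluation: if \<open>|f(z)|\<^sup>2 \<le> A(z) \<parallel>f\<parallel>\<^sup>2\<close> for all \<open>f\<close> in the
  space, then \<open>|K(w,z)|\<^sup>2 \<le> A(w) A(z)\<close> (\<open>reproducing_kernel_bound\<close>). The claim is thus the estimate
  \<open>|f(z)|\<^sup>2 \<le> C m\<^sup>2 e\<^bsup>m W(z)\<^esup> \<parallel>f\<parallel>\<^sup>2\<close>, with \<open>W\<close> the equilibrium weight, for \<open>f = g + z\<^sup>* h\<close> where \<open>g\<close>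
  and \<open>h\<close> are polynomials of degree below \<open>n\<close> and \<open>z\<^sup>*\<close> is the conjugate of \<open>z\<close>.

  Locally, on discs of radius \<open>m\<^bsup>-1/2\<^esup>\<close>, the weight \<open>mQ\<close> is up to a bounded error the real part of an affine
  holomorphic function, which can be absorbed into \<open>g\<close> and \<open>h\<close>. Averaging against \<open>1\<close> and \<open>s\<close> over such
  discs recovers \<open>f\<close> and its antiholomorphic derivative \<open>h\<close> at the centre, so that on any fixed disc
  \<open>|f|\<^sup>2\<close> and \<open>|h|\<^sup>2\<close> are at most \<open>C m\<^sup>2 e\<^bsup>mQ\<^esup> \<parallel>f\<parallel>\<^sup>2\<close> (\<open>bianalytic_weighted_estimate\<close>).

  To replace \<open>Q\<close> by \<open>W\<close> one needs subharmonic competitors, but \<open>log |f|\<close> is not subharmonic. Freezing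
  the conjugate variable repairs this: for fixed \<open>a\<close> the polynomial
  \<open>p(z) = g(z) + a\<^sup>* h(z) = f(z) - (z\<^sup>* - a\<^sup>*) h(z)\<close> has \<open>p(a) = f(a)\<close> and obeys the same local bound on
  a fixed disc, as long as \<open>a\<close> is bounded; for \<open>|a| > 1\<close> the polynomial \<open>z p(z) / a\<close> of degree at most
  \<open>n\<close> does so with a constant independent of \<open>a\<close>. Since \<open>n \<le> m\<close>, the function \<open>m\<^sup>-\<^sup>1 log |p|\<^sup>2\<close> grows
  no faster than \<open>log |z|\<^sup>2\<close>, and the maximum principle in the exterior of the unit disc
  (\<open>subharmonic_exterior_bound\<close>) together with the growth of \<open>Q\<close> shows that a bound by \<open>Q\<close> on a fixed
  large disc persists on the whole plane. Hence that function, up to a constant of order \<open>m\<^sup>-\<^sup>1 log m\<close>,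
  lies below the equilibrium weight (\<open>equilibrium_majorizes_polynomials\<close>).

  Working with the equilibrium weight requires that the greatest competitor exists. It is the upper
  semicontinuous regularization of the supremum of all competitors: the sub-mean value inequality
  survives by Fatou's lemma, and the exterior maximum principle supplies a uniform upper bound at
  infinity (\<open>admissible_le_equilibrium\<close>).\<close>

section \<open>Mean values of holomorphic functions over circles and discs\<close>

lemma holomorphic_circle_mean:
  fixes f :: "complex \<Rightarrow> complex"
  assumes "continuous_on (cball a r) f" "f holomorphic_on ball a r" "r > 0"
  shows "((\<lambda>t. f (a + of_real r * cis t)) has_integral (2 * pi * f a)) {0..2*pi}"
proof -
  have "((\<lambda>u. f u/(u-a)) has_contour_integral (2 * of_real pi * \<i> * f a)) (circlepath a r)"
    using Cauchy_integral_circlepath[OF assms(1,2), of a] assms(3) by simp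
  then have "((\<lambda>t. (f (a + r * cis t) / (a + r * cis t - a)) * r * \<i> * cis t)
       has_integral (2 * of_real pi * \<i> * f a)) {0..2*pi}"
    unfolding circlepath_def by (subst (asm) has_contour_integral_part_circlepath_iff) auto
  also have "(\<lambda>t. (f (a + r * cis t) / (a + r * cis t - a)) * r * \<i> * cis t)
     = (\<lambda>t. \<i> * f (a + r * cis t))"
    using assms(3) by (auto simp: fun_eq_iff)
  finally have "((\<lambda>t. \<i> * f (a + r * cis t)) has_integral (2 * of_real pi * \<i> * f a)) {0..2*pi}" .
  from has_integral_mult_right[OF this, of "-\<i>"]
  have "((\<lambda>t. -\<i> * (\<i> * f (a + r * cis t))) has_integral -\<i> * (2 * of_real pi * \<i> * f a)) {0..2*pi}" .
  moreover have "-\<i> * (2 * of_real pi * \<i> * f a) = 2 * pi * f a"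
    by (simp add: complex_eq_iff)
  ultimately show ?thesis by (simp only: mult_minus_left mult.assoc[symmetric] i_squared minus_minus mult_1 mult_minus_right)
qed

lemma nn_integral_lborel_translate:
  fixes g :: "'a::euclidean_space \<Rightarrow> ennreal"
  assumes [measurable]: "g \<in> borel_measurable borel"
  shows "(\<integral>\<^sup>+x. g (t + x) \<partial>lborel) = (\<integral>\<^sup>+x. g x \<partial>lborel)"
proof -
  have "(\<integral>\<^sup>+x. g x \<partial>lborel) = (\<integral>\<^sup>+x. g x \<partial>(distr lborel borel ((+) t)))"
    by (simp add: lborel_distr_plus)
  also have "\<dots> = (\<integral>\<^sup>+x. g (t + x) \<partial>lborel)"
    by (subst nn_integral_distr) auto
  finally show ?thesis ..
qed

text \<open>The uniqueness argument for Haar measure, applied to Lebesgue measure and its image under the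
  rotation: computing \<open>\<integral>\<integral> f(cx) g(y)\<close> with the substitutions \<open>y \<rightarrow> y - cx\<close> and \<open>x \<rightarrow> x + y/c\<close> shows that
  the two measures are proportional, and the unit disc, which the rotation preserves, fixes the
  factor.\<close>

lemma distr_lborel_rotation:
  fixes c :: complex
  assumes "norm c = 1"
  shows "distr lborel borel ((*) c) = lborel"
proof (rule measure_eqI)
  fix A assume "A \<in> sets (distr lborel borel ((*) c))"
  then have A[measurable]: "A \<in> sets borel" by simp
  have c0: "c \<noteq> 0" using assms by auto
  define f :: "complex \<Rightarrow> ennreal" where "f = indicator A"
  define g :: "complex \<Rightarrow> ennreal" where "g = indicator (ball 0 1)"
  have [measurable]: "f \<in> borel_measurable borel" "g \<in> borel_measurable borel"
    unfolding f_def g_def by (auto intro!: borel_measurable_indicator)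
  define v where "v = (\<integral>\<^sup>+y. g y \<partial>lborel)"
  have v: "v = ennreal pi"
    using emeasure_ball[of 1 "0::complex"] by (simp add: v_def g_def unit_ball_vol_2)
  have g': "g (- (c * x)) = g x" for x
    using assms by (auto simp: g_def indicator_def norm_mult)
  have "(\<integral>\<^sup>+x. f (c * x) \<partial>lborel) * v = (\<integral>\<^sup>+x. (\<integral>\<^sup>+y. f (c * x) * g y \<partial>lborel) \<partial>lborel)"
    by (simp add: v_def nn_integral_cmult nn_integral_multc)
  also have "\<dots> = (\<integral>\<^sup>+x. (\<integral>\<^sup>+y. f (c * x) * g (- (c * x) + y) \<partial>lborel) \<partial>lborel)"
    by (intro nn_integral_cong nn_integral_lborel_translate[symmetric]) measurable
  also have "\<dots> = (\<integral>\<^sup>+y. (\<integral>\<^sup>+x. f (c * x) * g (- (c * x) + y) \<partial>lborel) \<partial>lborel)"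
    by (rule lborel_pair.Fubini') measurable
  also have "\<dots> = (\<integral>\<^sup>+y. (\<integral>\<^sup>+x. f (c * (y / c + x)) * g (- (c * (y / c + x)) + y) \<partial>lborel) \<partial>lborel)"
    by (intro nn_integral_cong nn_integral_lborel_translate[symmetric]) measurable
  also have "\<dots> = (\<integral>\<^sup>+y. (\<integral>\<^sup>+x. f (c * x + y) * g x \<partial>lborel) \<partial>lborel)"
    using c0 g' by (simp add: algebra_simps)
  also have "\<dots> = (\<integral>\<^sup>+x. (\<integral>\<^sup>+y. f (c * x + y) * g x \<partial>lborel) \<partial>lborel)"
    by (rule lborel_pair.Fubini') measurable
  also have "\<dots> = (\<integral>\<^sup>+y. f y \<partial>lborel) * v"
    by (simp add: nn_integral_multc nn_integral_lborel_translate v_def nn_integral_cmult)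
  finally have "(\<integral>\<^sup>+x. f (c * x) \<partial>lborel) * v / v = (\<integral>\<^sup>+y. f y \<partial>lborel) * v / v"
    by simp
  then have "(\<integral>\<^sup>+x. f (c * x) \<partial>lborel) = (\<integral>\<^sup>+y. f y \<partial>lborel)"
    unfolding v by (subst (asm) (1 2) mult_divide_eq_ennreal) auto
  moreover have "emeasure (distr lborel borel ((*) c)) A = (\<integral>\<^sup>+x. f x \<partial>(distr lborel borel ((*) c)))"
    by (simp add: f_def)
  moreover have "\<dots> = (\<integral>\<^sup>+x. f (c * x) \<partial>lborel)"
    by (rule nn_integral_distr) auto
  moreover have "(\<integral>\<^sup>+y. f y \<partial>lborel) = emeasure lborel A"
    by (simp add: f_def)
  ultimately show "emeasure (distr lborel borel ((*) c)) A = emeasure lborel A"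
    by simp
qed simp

text \<open>Takes the place of polar coordinates: rotation invariance and Fubini replace the integrand by
  its mean over circles.\<close>

lemma integral_rotation_average:
  fixes F :: "complex \<Rightarrow> complex"
  assumes F: "continuous_on UNIV F"
  shows "2 * pi * (LINT s:cball 0 r|lborel. F s)
    = (LINT s:cball 0 r|lborel. LINT t:{0..2*pi}|lborel. F (cis t * s))"
proof -
  let ?S = "cball (0::complex) r"
  define f where "f = (\<lambda>t s. indicator {0..2*pi} t *\<^sub>R indicator ?S s *\<^sub>R F (cis t * s))"
  have [measurable]: "F \<in> borel_measurable borel"
    using F by (rule borel_measurable_continuous_onI)
  have [measurable]: "?S \<in> sets borel" by simp
  have "integrable lborel (\<lambda>x. indicator ({0..2*pi} \<times> ?S) x *\<^sub>R F (cis (fst x) * snd x))"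
    by (intro borel_integrable_compact compact_Times compact_Icc compact_cball
      continuous_on_compose2[OF F] continuous_intros) auto
  also have "(\<lambda>x. indicator ({0..2*pi} \<times> ?S) x *\<^sub>R F (cis (fst x) * snd x)) = case_prod f"
    by (auto simp: f_def indicator_def fun_eq_iff)
  finally have int: "integrable (lborel \<Otimes>\<^sub>M lborel) (case_prod f)"
    by (simp add: lborel_prod)
  have rot: "(\<integral>s. indicator ?S s *\<^sub>R F (cis t * s) \<partial>lborel) = (LINT s:?S|lborel. F s)" for t
  proof -
    have "(LINT s:?S|lborel. F s) = (\<integral>s. indicator ?S s *\<^sub>R F s \<partial>(distr lborel borel ((*) (cis t))))"
      unfolding distr_lborel_rotation[OF norm_cis] by (simp add: set_lebesgue_integral_def)
    also have "\<dots> = (\<integral>s. indicator ?S (cis t * s) *\<^sub>R F (cis t * s) \<partial>lborel)"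
      by (rule integral_distr) auto
    also have "\<dots> = (\<integral>s. indicator ?S s *\<^sub>R F (cis t * s) \<partial>lborel)"
      by (simp add: indicator_def norm_mult)
    finally show ?thesis ..
  qed
  have "2 * pi * (LINT s:?S|lborel. F s) = (\<integral>t. indicator {0..2*pi} t *\<^sub>R (LINT s:?S|lborel. F s) \<partial>lborel)"
    by (simp add: scaleR_conv_of_real)
  also have "\<dots> = (\<integral>t. (\<integral>s. f t s \<partial>lborel) \<partial>lborel)"
    by (simp only: rot f_def integral_scaleR_right)
  also have "\<dots> = (\<integral>s. (\<integral>t. f t s \<partial>lborel) \<partial>lborel)"
    by (rule lborel_pair.Fubini_integral[OF int, symmetric])
  also have "\<dots> = (LINT s:?S|lborel. LINT t:{0..2*pi}|lborel. F (cis t * s))"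
    unfolding set_lebesgue_integral_def f_def
    by (intro Bochner_Integration.integral_cong refl) (auto simp: indicator_def)
  finally show ?thesis .
qed

lemma holomorphic_rotation_mean:
  fixes f :: "complex \<Rightarrow> complex"
  assumes "f holomorphic_on UNIV"
  shows "(LINT t:{0..2*pi}|lborel. f (cis t * s)) = 2 * pi * f 0"
proof -
  have h: "(\<lambda>z. f (z * s)) holomorphic_on UNIV"
    using holomorphic_on_compose_gen[OF _ assms, of "\<lambda>z. z * s" UNIV]
    unfolding o_def by (rule) (auto intro!: holomorphic_intros)
  have c: "continuous_on A (\<lambda>z. f (z * s))" for A
    using h holomorphic_on_imp_continuous_on holomorphic_on_subset by blast
  have "((\<lambda>t. f (cis t * s)) has_integral (2 * pi * f 0)) {0..2*pi}"
    using holomorphic_circle_mean[of 0 1 "\<lambda>z. f (z * s)", OF c holomorphic_on_subset[OF h]] by simp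
  moreover have "set_integrable lborel {0..2*pi} (\<lambda>t. f (cis t * s))"
    by (intro borel_integrable_atLeastAtMost' continuous_on_compose2[OF c[of UNIV]] continuous_intros) auto
  ultimately show ?thesis
    by (simp add: set_borel_integral_eq_integral(2) integral_unique)
qed

text \<open>The inequality used is that the variance of \<open>|F|\<close> under the uniform distribution on the unit
  disc is nonnegative.\<close>

lemma cauchy_schwarz_cball:
  fixes F :: "complex \<Rightarrow> complex"
  assumes F: "continuous_on UNIV F" and "0 \<le> r" "r \<le> 1"
  shows "(norm (LINT s:cball 0 r|lborel. F s))\<^sup>2 \<le> pi * (LINT s:cball 0 1|lborel. (norm (F s))\<^sup>2)"
proof -
  have int: "set_integrable lborel (cball 0 R) g" if "continuous_on UNIV g" for R and g :: "complex \<Rightarrow> 'b::{banach,second_countable_topology}"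
    unfolding set_integrable_def
    by (intro borel_integrable_compact compact_cball continuous_on_subset[OF that]) auto
  have nF: "continuous_on UNIV (\<lambda>s. norm (F s))"
    using F by (intro continuous_intros)
  have nF2: "continuous_on UNIV (\<lambda>s. (norm (F s))\<^sup>2)"
    using F by (intro continuous_intros)
  define I where "I = (LINT s:cball 0 1|lborel. norm (F s))"
  define J where "J = (LINT s:cball 0 1|lborel. (norm (F s))\<^sup>2)"
  have v: "measure lborel (cball (0::complex) 1) = pi"
    using content_cball[of 1 "0::complex"] by (simp add: unit_ball_vol_2)
  have "norm (LINT s:cball 0 r|lborel. F s) \<le> (LINT s:cball 0 r|lborel. norm (F s))"
    by (intro set_integral_norm_bound int F)
  also have "\<dots> \<le> I"
    unfolding I_def set_lebesgue_integral_def using assms(3) int[OF nF, unfolded set_integrable_def]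
    by (intro integral_mono) (auto simp: indicator_def)
  finally have 1: "norm (LINT s:cball 0 r|lborel. F s) \<le> I" .
  have "0 \<le> (LINT s:cball 0 1|lborel. (norm (F s) - I / pi)\<^sup>2)"
    unfolding set_lebesgue_integral_def by (intro integral_nonneg_AE) auto
  also have "\<dots> = (LINT s:cball 0 1|lborel. (norm (F s))\<^sup>2 - (2 * I / pi) * norm (F s) + (I/pi)\<^sup>2)"
    by (simp add: power2_eq_square algebra_simps)
  also have "\<dots> = (LINT s:cball 0 1|lborel. (norm (F s))\<^sup>2 - (2 * I / pi) * norm (F s))
      + (LINT s:cball (0::complex) 1|lborel. (I/pi)\<^sup>2)"
    by (intro set_integral_add(2) set_integral_diff(1) set_integrable_mult_right int nF nF2 continuous_on_const)
  also have "(LINT s:cball 0 1|lborel. (norm (F s))\<^sup>2 - (2 * I / pi) * norm (F s))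
      = J - (LINT s:cball 0 1|lborel. (2 * I / pi) * norm (F s))"
    unfolding J_def by (intro set_integral_diff(2) set_integrable_mult_right int nF nF2)
  also have "(LINT s:cball 0 1|lborel. (2 * I / pi) * norm (F s)) = (2 * I / pi) * I"
    unfolding I_def by (rule set_integral_mult_right)
  also have "(LINT s:cball (0::complex) 1|lborel. (I/pi)\<^sup>2) = pi * (I/pi)\<^sup>2"
    using v by (simp add: set_lebesgue_integral_def)
  also have "J - (2 * I / pi) * I + pi * (I / pi)\<^sup>2 = J - I\<^sup>2 / pi"
  proof -
    have "(2 * I / pi) * I = 2 * (I\<^sup>2 / pi)" "pi * (I / pi)\<^sup>2 = I\<^sup>2 / pi"
      by (simp_all add: power2_eq_square)
    then show ?thesis by linarith
  qed
  finally have "I\<^sup>2 \<le> pi * J"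
    by (simp add: field_simps)
  then show ?thesis
    using 1 power_mono[OF 1, of 2] unfolding J_def by simp
qed

section \<open>Pointwise estimates for bianalytic functions\<close>

lemma lborel_integral_scale:
  fixes f :: "complex \<Rightarrow> 'b::{banach,second_countable_topology}"
  assumes [measurable]: "f \<in> borel_measurable borel" and "c > 0"
  shows "(\<integral>x. f x \<partial>lborel) = c\<^sup>2 *\<^sub>R (\<integral>x. f (t + c *\<^sub>R x) \<partial>lborel)"
proof -
  have "(\<integral>x. f x \<partial>lborel)
      = (\<integral>x. f x \<partial>(density (distr lborel borel (\<lambda>x. t + c *\<^sub>R x)) (\<lambda>_. ennreal (c\<^sup>2))))"
    using \<open>c > 0\<close> by (subst lborel_affine[of c t]) (simp_all add: ennreal_power)
  also have "\<dots> = (\<integral>x. c\<^sup>2 *\<^sub>R f x \<partial>(distr lborel borel (\<lambda>x. t + c *\<^sub>R x)))"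
    by (rule integral_density) auto
  also have "\<dots> = (\<integral>x. c\<^sup>2 *\<^sub>R f (t + c *\<^sub>R x) \<partial>lborel)"
    by (rule integral_distr) auto
  finally show ?thesis by simp
qed

lemma lborel_integrable_scale:
  fixes f :: "complex \<Rightarrow> real"
  assumes int: "integrable lborel f" and "c > 0"
  shows "integrable lborel (\<lambda>x. f (t + c *\<^sub>R x))"
proof -
  have [measurable]: "f \<in> borel_measurable borel" using int by auto
  have "integrable (density (distr lborel borel (\<lambda>x. t + c *\<^sub>R x)) (\<lambda>_. ennreal (c\<^sup>2))) f"
    using int \<open>c > 0\<close> by (subst (asm) lborel_affine[of c t]) (simp_all add: ennreal_power)
  then have "integrable (distr lborel borel (\<lambda>x. t + c *\<^sub>R x)) (\<lambda>x. c\<^sup>2 *\<^sub>R f x)"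
    by (subst (asm) integrable_density) auto
  then have "integrable lborel (\<lambda>x. c\<^sup>2 *\<^sub>R f (t + c *\<^sub>R x))"
    by (subst (asm) integrable_distr_eq) auto
  with \<open>c > 0\<close> show ?thesis by simp
qed

lemma set_integrable_cball:
  fixes g :: "complex \<Rightarrow> 'b::{banach,second_countable_topology}"
  assumes "continuous_on UNIV g"
  shows "set_integrable lborel (cball a r) g"
  unfolding set_integrable_def
  by (intro borel_integrable_compact compact_cball continuous_on_subset[OF assms]) auto

definition second_moment :: "real \<Rightarrow> real" where
  "second_moment r = (LINT s:cball (0::complex) r|lborel. (norm s)\<^sup>2)"

lemma second_moment_half: "second_moment 1 = 16 * second_moment (1/2)"
proof -
  have [measurable]: "cball (0::complex) (1/2) \<in> sets borel" by simp
  have "second_moment (1/2) = (1/2)\<^sup>2 *\<^sub>R (\<integral>x. indicator (cball (0::complex) (1/2)) (0 + (1/2) *\<^sub>R x) *\<^sub>R (norm (0 + (1/2) *\<^sub>R x))\<^sup>2 \<partial>lborel)"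
    unfolding second_moment_def set_lebesgue_integral_def
    by (rule lborel_integral_scale) auto
  also have "\<dots> = (1/4) * (\<integral>x. (1/4) * (indicator (cball (0::complex) 1) x *\<^sub>R (norm x)\<^sup>2) \<partial>lborel)"
    by (simp add: indicator_def power2_eq_square if_distrib if_distribR)
  also have "\<dots> = (1/16) * second_moment 1"
    unfolding second_moment_def set_lebesgue_integral_def by simp
  finally show ?thesis by simp
qed

lemma second_moment_bound: "second_moment 1 \<ge> pi / 64"
proof -
  have "(\<integral>s. indicator (cball (3/4::complex) (1/4)) s *\<^sub>R (1/4::real) \<partial>lborel) \<le> second_moment 1"
    unfolding second_moment_def set_lebesgue_integral_def
  proof (rule integral_mono)
    show "integrable lborel (\<lambda>s. indicator (cball (3/4::complex) (1/4)) s *\<^sub>R (1/4::real))"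
      using set_integrable_cball[of "\<lambda>_. 1/4::real", OF continuous_on_const] by (simp add: set_integrable_def)
    show "integrable lborel (\<lambda>s. indicator (cball (0::complex) 1) s *\<^sub>R (norm s)\<^sup>2)"
      using set_integrable_cball[of "\<lambda>s. (norm s)\<^sup>2"] by (simp add: set_integrable_def continuous_intros)
    fix s :: complex
    have "norm s \<le> 1 \<and> 1/4 \<le> (norm s)\<^sup>2" if "norm (3/4 - s) \<le> 1/4"
    proof -
      have n: "norm (3/4::complex) = 3/4" by (simp add: norm_divide)
      have "norm s \<le> norm (3/4::complex) + norm (3/4 - s)" by (metis norm_minus_commute norm_triangle_sub)
      moreover have "norm (3/4::complex) \<le> norm s + norm (3/4 - s)" by (metis norm_triangle_sub)
      ultimately have "norm s \<le> 1" "1/2 \<le> norm s" using that n by auto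
      then show ?thesis using power_mono[of "1/2" "norm s" 2] by (simp add: power2_eq_square)
    qed
    then show "indicator (cball (3/4::complex) (1/4)) s *\<^sub>R (1/4::real) \<le> indicator (cball (0::complex) 1) s *\<^sub>R (norm s)\<^sup>2"
      by (auto simp: indicator_def dist_norm)
  qed
  moreover have "(\<integral>s. indicator (cball (3/4::complex) (1/4)) s *\<^sub>R (1/4::real) \<partial>lborel) = pi / 64"
    using content_cball[of "1/4" "3/4::complex"] by (simp add: unit_ball_vol_2 power2_eq_square)
  ultimately show ?thesis by simp
qed

text \<open>Angular averaging kills the purely antiholomorphic term and evaluates \<open>G\<close> and \<open>K\<close> at the centre.
  A function \<open>G + s\<^sup>* H\<close> has this form after the splitting \<open>H(s) = H(0) + s K(s)\<close>.\<close>

lemma disc_integral: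
  fixes G K :: "complex \<Rightarrow> complex"
  assumes G: "G holomorphic_on UNIV" and K: "K holomorphic_on UNIV" and "r \<ge> 0"
  shows "(LINT s:cball 0 r|lborel. G s + (cnj s * a + of_real ((norm s)\<^sup>2) * K s))
     = pi * r\<^sup>2 * G 0 + second_moment r * K 0"
proof -
  note [continuous_intros] = continuous_on_compose2[OF holomorphic_on_imp_continuous_on[OF G]]
    continuous_on_compose2[OF holomorphic_on_imp_continuous_on[OF K]]
  let ?F = "\<lambda>s. G s + (cnj s * a + of_real ((norm s)\<^sup>2) * K s)"
  have F: "continuous_on UNIV ?F"
    by (intro continuous_intros) auto
  have ints: "set_integrable lborel {0..2*pi} f" if "continuous_on {0..2*pi} f" for f :: "real \<Rightarrow> complex"
    by (rule borel_integrable_atLeastAtMost'[OF that])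
  have inner: "(LINT t:{0..2*pi}|lborel. ?F (cis t * s)) = 2 * pi * (G 0 + of_real ((norm s)\<^sup>2) * K 0)" for s
  proof -
    have "(LINT t:{0..2*pi}|lborel. ?F (cis t * s)) =
      (LINT t:{0..2*pi}|lborel. G (cis t * s)) +
      (LINT t:{0..2*pi}|lborel. cnj (cis t * s) * a + of_real ((norm (cis t * s))\<^sup>2) * K (cis t * s))"
      by (rule set_integral_add(2); intro ints continuous_intros; simp)
    also have "(LINT t:{0..2*pi}|lborel. cnj (cis t * s) * a + of_real ((norm (cis t * s))\<^sup>2) * K (cis t * s))
      = (LINT t:{0..2*pi}|lborel. cnj (cis t * s) * a)
       + (LINT t:{0..2*pi}|lborel. of_real ((norm (cis t * s))\<^sup>2) * K (cis t * s))"
      by (rule set_integral_add(2); intro ints continuous_intros; simp)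
    also have "(LINT t:{0..2*pi}|lborel. G (cis t * s)) = 2 * pi * G 0"
      by (rule holomorphic_rotation_mean[OF G])
    also have "(LINT t:{0..2*pi}|lborel. of_real ((norm (cis t * s))\<^sup>2) * K (cis t * s)) = (norm s)\<^sup>2 * (2 * pi * K 0)"
      by (simp add: norm_mult holomorphic_rotation_mean[OF K])
    also have "(LINT t:{0..2*pi}|lborel. cnj (cis t * s) * a) = cnj (LINT t:{0..2*pi}|lborel. (cis t * s) * cnj a)"
      unfolding set_lebesgue_integral_def by (subst Bochner_Integration.integral_cnj[symmetric]) simp
    also have "(LINT t:{0..2*pi}|lborel. (cis t * s) * cnj a) = 0"
      by (subst holomorphic_rotation_mean[of "\<lambda>z. z * cnj a"]) (auto intro!: holomorphic_intros)
    finally show ?thesis by (simp add: algebra_simps)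
  qed
  have "2 * pi * (LINT s:cball 0 r|lborel. ?F s)
    = (LINT s:cball (0::complex) r|lborel. 2 * pi * (G 0 + of_real ((norm s)\<^sup>2) * K 0))"
    using integral_rotation_average[OF F, of r] unfolding inner .
  also have "\<dots> = 2 * pi * (LINT s:cball (0::complex) r|lborel. G 0 + of_real ((norm s)\<^sup>2) * K 0)"
    by (rule set_integral_mult_right)
  also have "(LINT s:cball (0::complex) r|lborel. G 0 + of_real ((norm s)\<^sup>2) * K 0)
     = (LINT s:cball (0::complex) r|lborel. G 0) + (LINT s:cball (0::complex) r|lborel. of_real ((norm s)\<^sup>2) * K 0)"
    by (intro set_integral_add(2) set_integrable_cball continuous_intros)
  also have "(LINT s:cball (0::complex) r|lborel. G 0) = pi * r\<^sup>2 * G 0"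
    using content_cball[of r "0::complex"] \<open>r \<ge> 0\<close>
    by (simp add: set_lebesgue_integral_def unit_ball_vol_2 scaleR_conv_of_real)
  also have "(LINT s:cball (0::complex) r|lborel. of_real ((norm s)\<^sup>2) * K 0)
      = (LINT s:cball (0::complex) r|lborel. of_real ((norm s)\<^sup>2)) * K 0"
    by (rule set_integral_mult_left)
  also have "(LINT s:cball (0::complex) r|lborel. complex_of_real ((norm s)\<^sup>2)) = second_moment r"
    unfolding second_moment_def by (rule set_integral_complex_of_real)
  finally show ?thesis by simp
qed

text \<open>The integral over a disc of radius \<open>r\<close> contains \<open>H'(0)\<close> with a factor proportional to \<open>r\<^sup>4\<close>, while
  \<open>G(0)\<close> comes with \<open>r\<^sup>2\<close>; comparing two radii isolates \<open>G(0)\<close>. Integrating against \<open>s\<close> isolates \<open>H(0)\<close>.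
  The constant is not sharp.\<close>

lemma bianalytic_disc_estimate:
  fixes G H :: "complex \<Rightarrow> complex"
  assumes G: "G holomorphic_on UNIV" and H: "H holomorphic_on UNIV"
  defines "J \<equiv> (LINT s:cball 0 1|lborel. (norm (G s + cnj s * H s))\<^sup>2)"
  shows "(norm (G 0))\<^sup>2 \<le> 4096 * J" "(norm (H 0))\<^sup>2 \<le> 4096 * J"
proof -
  note [continuous_intros] = continuous_on_compose2[OF holomorphic_on_imp_continuous_on[OF G]]
    continuous_on_compose2[OF holomorphic_on_imp_continuous_on[OF H]]
  let ?F = "\<lambda>s. G s + cnj s * H s"
  define H1 where "H1 = (\<lambda>z. if z = 0 then deriv H 0 else (H z - H 0) / (z - 0))"
  have H1: "H1 holomorphic_on UNIV"
    unfolding H1_def by (rule pole_lemma_open[OF H open_UNIV])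
  have eq: "?F s = G s + (cnj s * H 0 + of_real ((norm s)\<^sup>2) * H1 s)" for s
  proof -
    have "cnj s * H s = cnj s * (H 0 + s * H1 s)" by (simp add: H1_def)
    moreover have "of_real ((norm s)\<^sup>2) = s * cnj s" by (rule complex_norm_square)
    ultimately show ?thesis by (simp only: algebra_simps)
  qed
  have F: "continuous_on UNIV ?F"
    by (intro continuous_intros) auto
  define T where "T = (\<lambda>r. LINT s:cball 0 r|lborel. ?F s)"
  have T: "T r = pi * r\<^sup>2 * G 0 + second_moment r * H1 0" if "r \<ge> 0" for r
    unfolding T_def eq using disc_integral[OF G H1 that] .
  have T_bound: "(norm (T r))\<^sup>2 \<le> pi * J" if "0 \<le> r" "r \<le> 1" for r
    unfolding T_def J_def by (rule cauchy_schwarz_cball[OF F that])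
  have J0: "J \<ge> 0"
    unfolding J_def set_lebesgue_integral_def by (intro integral_nonneg_AE) auto
  have Tb: "norm (T r) \<le> sqrt (pi * J)" if "0 \<le> r" "r \<le> 1" for r
    using T_bound[OF that] by (rule real_le_rsqrt)
  \<comment> \<open>The weights 16 and 1 cancel the \<open>H1\<close> terms because the second moment scales like \<open>r ^ 4\<close>.\<close>
  have "3 * pi * G 0 = 16 * T (1/2) - T 1"
    using second_moment_half by (simp add: T power2_eq_square algebra_simps)
  then have "3 * pi * norm (G 0) = norm (16 * T (1/2) - T 1)"
    by (metis (no_types, opaque_lifting) norm_mult norm_of_real abs_of_nonneg pi_ge_zero norm_numeral of_real_mult of_real_numeral)
  also have "\<dots> \<le> 16 * norm (T (1/2)) + norm (T 1)"
    by (metis norm_triangle_ineq4 norm_mult norm_numeral)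
  also have "\<dots> \<le> 17 * sqrt (pi * J)"
    using Tb[of "1/2"] Tb[of 1] by simp
  finally have "(3 * pi * norm (G 0))\<^sup>2 \<le> (17 * sqrt (pi * J))\<^sup>2"
    by (intro power_mono) auto
  moreover have "(17 * sqrt (pi * J))\<^sup>2 = pi * (289 * J)"
    using J0 by (simp add: power_mult_distrib)
  moreover have "(3 * pi * norm (G 0))\<^sup>2 = pi * (9 * pi * (norm (G 0))\<^sup>2)"
    by (simp add: power2_eq_square)
  ultimately have "pi * (9 * pi * (norm (G 0))\<^sup>2) \<le> pi * (289 * J)"
    by simp
  then have "9 * pi * (norm (G 0))\<^sup>2 \<le> 289 * J"
    by (subst (asm) mult_le_cancel_left_pos) auto
  moreover have "27 * (norm (G 0))\<^sup>2 \<le> 9 * pi * (norm (G 0))\<^sup>2"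
    using pi_gt3 by (intro mult_right_mono) auto
  ultimately show "(norm (G 0))\<^sup>2 \<le> 4096 * J"
    using J0 by linarith
  have sG: "(\<lambda>s. s * G s) holomorphic_on UNIV" by (intro holomorphic_intros G)
  have "(LINT s:cball 0 1|lborel. s * ?F s) = (LINT s:cball 0 1|lborel. s * G s + (cnj s * 0 + of_real ((norm s)\<^sup>2) * H s))"
    by (simp only: complex_norm_square) (simp add: algebra_simps)
  also have "\<dots> = second_moment 1 * H 0"
    using disc_integral[OF sG H, of 1 0] by simp
  finally have "(norm (second_moment 1 * H 0))\<^sup>2 \<le> pi * (LINT s:cball 0 1|lborel. (norm (s * ?F s))\<^sup>2)"
    using cauchy_schwarz_cball[of "\<lambda>s. s * ?F s" 1] by (simp add: F continuous_on_mult)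
  also have "(LINT s:cball 0 1|lborel. (norm (s * ?F s))\<^sup>2) \<le> J"
    unfolding J_def
  proof (rule set_integral_mono)
    show "set_integrable lborel (cball 0 1) (\<lambda>s. (norm (s * ?F s))\<^sup>2)"
      "set_integrable lborel (cball 0 1) (\<lambda>s. (norm (?F s))\<^sup>2)"
      by (intro set_integrable_cball continuous_intros; simp)+
    fix s :: complex assume "s \<in> cball 0 1"
    then show "(norm (s * ?F s))\<^sup>2 \<le> (norm (?F s))\<^sup>2"
      by (intro power_mono) (auto simp: norm_mult intro!: mult_left_le_one_le)
  qed
  finally have "(second_moment 1)\<^sup>2 * (norm (H 0))\<^sup>2 \<le> pi * J"
    by (simp add: norm_mult power_mult_distrib)
  moreover have "(pi / 64)\<^sup>2 * (norm (H 0))\<^sup>2 \<le> (second_moment 1)\<^sup>2 * (norm (H 0))\<^sup>2"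
    using second_moment_bound by (intro mult_right_mono power_mono) auto
  moreover have "(pi / 64)\<^sup>2 * (norm (H 0))\<^sup>2 = pi * (pi * (norm (H 0))\<^sup>2) / 4096"
    by (simp add: power2_eq_square)
  ultimately have "pi * (pi * (norm (H 0))\<^sup>2) \<le> pi * (4096 * J)"
    by linarith
  then have "pi * (norm (H 0))\<^sup>2 \<le> 4096 * J"
    by (subst (asm) mult_le_cancel_left_pos) auto
  moreover have "1 * (norm (H 0))\<^sup>2 \<le> pi * (norm (H 0))\<^sup>2"
    using pi_gt3 by (intro mult_right_mono) auto
  ultimately show "(norm (H 0))\<^sup>2 \<le> 4096 * J" by linarith
qed

text \<open>At the scale \<open>1 / sqrt m\<close> the quadratic part of \<open>mQ\<close> contributes at most \<open>M\<close>, and its linear part is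
  the logarithm of the squared modulus of an exponential \<open>E\<close>. Multiplying \<open>g + z\<^sup>* h\<close> by \<open>E\<close> keeps
  it bianalytic, so that the unweighted estimate on the unit disc applies after rescaling. The
  conjugate variable is also rescaled, which costs the additional factor \<open>m\<close> for \<open>h\<close>.\<close>

lemma bianalytic_weighted_estimate:
  fixes g h :: "complex \<Rightarrow> complex" and Q :: "complex \<Rightarrow> real"
  assumes g: "g holomorphic_on UNIV" and h: "h holomorphic_on UNIV"
    and Q: "continuous_on UNIV Q" and m: "m > 0"
    and Qle: "\<And>z. norm (z - a) \<le> 1 / sqrt m \<Longrightarrow> Q z \<le> Q a + Re (l * (z - a)) + M * (norm (z - a))\<^sup>2"
    and M: "M \<ge> 0"
    and int: "integrable (weighted_area m Q) (\<lambda>z. (norm (g z + cnj z * h z))\<^sup>2)"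
  defines "N \<equiv> (\<integral>z. (norm (g z + cnj z * h z))\<^sup>2 \<partial>weighted_area m Q)"
  shows "(norm (g a + cnj a * h a))\<^sup>2 \<le> 4096 * pi * exp M * m * exp (m * Q a) * N"
    and "(norm (h a))\<^sup>2 \<le> 4096 * pi * exp M * m\<^sup>2 * exp (m * Q a) * N"
proof -
  note cont [continuous_intros] = continuous_on_compose2[OF holomorphic_on_imp_continuous_on[OF g]]
    continuous_on_compose2[OF holomorphic_on_imp_continuous_on[OF h]]
    continuous_on_compose2[OF Q]
  define \<rho> where "\<rho> = 1 / sqrt m"
  have \<rho>: "\<rho> > 0" "m * \<rho>\<^sup>2 = 1" "\<rho>\<^sup>2 = 1 / m"
    using m by (auto simp: \<rho>_def power_divide)
  define f where "f = (\<lambda>z. g z + cnj z * h z)"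
  define W where "W = (\<lambda>z. (norm (f z))\<^sup>2 * exp (- m * Q z))"
  have feq: "g z + cnj z * h z = f z" for z by (simp add: f_def)
  have f: "continuous_on UNIV f" unfolding f_def by (intro continuous_intros) auto
  have "continuous_on UNIV W"
    unfolding W_def by (intro continuous_intros f) auto
  then have W[measurable]: "W \<in> borel_measurable borel"
    by (rule borel_measurable_continuous_onI)
  have [measurable]: "Q \<in> borel_measurable borel" "f \<in> borel_measurable borel"
    using Q f by (auto intro: borel_measurable_continuous_onI)
  have "integrable lborel (\<lambda>z. (exp (- m * Q z) / pi) *\<^sub>R (norm (f z))\<^sup>2)"
    using int unfolding weighted_area_def feq by (subst (asm) integrable_density) auto
  then have "integrable lborel (\<lambda>z. pi * ((exp (- m * Q z) / pi) *\<^sub>R (norm (f z))\<^sup>2))"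
    by (rule integrable_mult_right)
  then have Wint: "integrable lborel W"
    by (simp add: W_def mult.commute)
  have "N = (\<integral>z. (exp (- m * Q z) / pi) *\<^sub>R (norm (f z))\<^sup>2 \<partial>lborel)"
    unfolding N_def weighted_area_def feq by (rule integral_density) auto
  also have "\<dots> = (\<integral>z. W z / pi \<partial>lborel)"
    by (simp add: W_def mult.commute)
  finally have N: "(\<integral>z. W z \<partial>lborel) = pi * N" by simp
  define E :: "complex \<Rightarrow> complex" where "E = (\<lambda>s. exp (- (m * \<rho> / 2) * l * s))"
  \<comment> \<open>Recentring: \<open>cnj (a + \<rho> s) = cnj a + \<rho> cnj s\<close> moves the part \<open>cnj a * h\<close> into \<open>G\<close>.\<close>
  define G :: "complex \<Rightarrow> complex" where "G = (\<lambda>s. (g (a + of_real \<rho> * s) + cnj a * h (a + of_real \<rho> * s)) * E s)"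
  define H :: "complex \<Rightarrow> complex" where "H = (\<lambda>s. of_real \<rho> * h (a + of_real \<rho> * s) * E s)"
  have sh: "(\<lambda>s. k (a + of_real \<rho> * s)) holomorphic_on UNIV" if k: "k holomorphic_on UNIV" for k :: "complex \<Rightarrow> complex"
    using holomorphic_on_compose_gen[OF _ k, of "\<lambda>s. a + of_real \<rho> * s" UNIV]
    unfolding o_def by (rule) (auto intro!: holomorphic_intros)
  have E: "E holomorphic_on UNIV" unfolding E_def by (intro holomorphic_intros)
  have G: "G holomorphic_on UNIV" and H: "H holomorphic_on UNIV"
    unfolding G_def H_def by (intro holomorphic_intros sh g h E)+
  have FE: "G s + cnj s * H s = f (a + of_real \<rho> * s) * E s" for s
    by (simp add: G_def H_def f_def algebra_simps)
  have FW: "(norm (G s + cnj s * H s))\<^sup>2 \<le> exp (M + m * Q a) * W (a + \<rho> *\<^sub>R s)" if "norm s \<le> 1" for s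
  proof -
    let ?z = "a + of_real \<rho> * s"
    have n: "norm (?z - a) = \<rho> * norm s" using \<rho> by (simp add: norm_mult)
    also have "\<dots> \<le> \<rho> * 1" using \<rho> that by (intro mult_left_mono) auto
    finally have "Q ?z \<le> Q a + Re (l * (?z - a)) + M * (norm (?z - a))\<^sup>2"
      by (intro Qle) (simp add: \<rho>_def)
    moreover have "m * (M * (norm (?z - a))\<^sup>2) \<le> M"
    proof -
      have "m * (M * (norm (?z - a))\<^sup>2) = M * (norm s)\<^sup>2 * (m * \<rho>\<^sup>2)"
        unfolding n by (simp add: power_mult_distrib)
      also have "\<dots> \<le> M * 1" unfolding \<rho>(2)
        using that M by (simp add: mult_left_le power_le_one)
      finally show ?thesis by simp
    qed
    ultimately have "m * Q ?z \<le> m * Q a + m * \<rho> * Re (l * s) + M"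
    proof -
      assume a1: "Q ?z \<le> Q a + Re (l * (?z - a)) + M * (norm (?z - a))\<^sup>2"
        and a2: "m * (M * (norm (?z - a))\<^sup>2) \<le> M"
      have "m * Q ?z \<le> m * (Q a + Re (l * (?z - a)) + M * (norm (?z - a))\<^sup>2)"
        using a1 m by (intro mult_left_mono) auto
      moreover have "Re (l * (?z - a)) = \<rho> * Re (l * s)" by (simp add: algebra_simps)
      ultimately show ?thesis using a2 by (simp add: algebra_simps)
    qed
    then have "- (m * \<rho> * Re (l * s)) \<le> M + m * Q a + (- m * Q ?z)" by simp
    moreover have "(norm (E s))\<^sup>2 = exp (- (m * \<rho> * Re (l * s)))"
      by (simp add: E_def power2_eq_square exp_add[symmetric] algebra_simps)
    ultimately have "(norm (E s))\<^sup>2 \<le> exp (M + m * Q a) * exp (- m * Q ?z)"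
      by (simp add: exp_add[symmetric])
    then have "(norm (f ?z))\<^sup>2 * (norm (E s))\<^sup>2 \<le> (norm (f ?z))\<^sup>2 * (exp (M + m * Q a) * exp (- m * Q ?z))"
      by (intro mult_left_mono) auto
    then show ?thesis
      by (simp add: FE norm_mult power_mult_distrib W_def scaleR_conv_of_real algebra_simps)
  qed
  define J where "J = (LINT s:cball 0 1|lborel. (norm (G s + cnj s * H s))\<^sup>2)"
  have "J \<le> (\<integral>s. exp (M + m * Q a) * W (a + \<rho> *\<^sub>R s) \<partial>lborel)"
    unfolding J_def set_lebesgue_integral_def
  proof (rule integral_mono)
    have "continuous_on UNIV (\<lambda>s. (norm (G s + cnj s * H s))\<^sup>2)"
      by (intro continuous_intros holomorphic_on_imp_continuous_on G H)
    from set_integrable_cball[OF this, of 0 1]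
    show "integrable lborel (\<lambda>s. indicator (cball 0 1) s *\<^sub>R (norm (G s + cnj s * H s))\<^sup>2)"
      unfolding set_integrable_def .
    show "integrable lborel (\<lambda>s. exp (M + m * Q a) * W (a + \<rho> *\<^sub>R s))"
      by (intro integrable_mult_right lborel_integrable_scale Wint \<rho>)
    show "indicator (cball 0 1) s *\<^sub>R (norm (G s + cnj s * H s))\<^sup>2 \<le> exp (M + m * Q a) * W (a + \<rho> *\<^sub>R s)" for s
      using FW[of s] by (auto simp: indicator_def W_def)
  qed
  also have "\<dots> = exp (M + m * Q a) * (\<integral>s. W (a + \<rho> *\<^sub>R s) \<partial>lborel)" by simp
  also have "(\<integral>s. W (a + \<rho> *\<^sub>R s) \<partial>lborel) = m * (pi * N)"
    using lborel_integral_scale[OF W \<rho>(1), of a] \<rho> m by (simp add: N field_simps)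
  finally have J: "J \<le> pi * exp M * m * exp (m * Q a) * N"
    by (simp add: exp_add mult_ac)
  have "(norm (f a))\<^sup>2 = (norm (G 0))\<^sup>2" by (simp add: G_def E_def f_def)
  also have "\<dots> \<le> 4096 * J" unfolding J_def by (rule bianalytic_disc_estimate(1)[OF G H])
  also have "\<dots> \<le> 4096 * (pi * exp M * m * exp (m * Q a) * N)" using J by simp
  finally show "(norm (g a + cnj a * h a))\<^sup>2 \<le> 4096 * pi * exp M * m * exp (m * Q a) * N"
    by (simp add: f_def mult_ac)
  have "(norm (h a))\<^sup>2 = m * (norm (H 0))\<^sup>2"
    using \<rho> m by (simp add: H_def E_def norm_mult power_mult_distrib)
  also have "\<dots> \<le> m * (4096 * J)" unfolding J_def
    using m by (intro mult_left_mono bianalytic_disc_estimate(2)[OF G H]) auto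
  also have "\<dots> \<le> m * (4096 * (pi * exp M * m * exp (m * Q a) * N))" using J m by simp
  finally show "(norm (h a))\<^sup>2 \<le> 4096 * pi * exp M * m\<^sup>2 * exp (m * Q a) * N"
    by (simp add: power2_eq_square mult_ac)
qed

section \<open>Circle means and subharmonic functions\<close>

lemma ereal_integral_real:
  assumes "integrable M f"
  shows "ereal_integral M (\<lambda>x. ereal (f x)) = ereal (\<integral>x. f x \<partial>M)"
proof -
  from assms obtain p q where "(\<integral>\<^sup>+x. ennreal (f x) \<partial>M) = ennreal p" "(\<integral>\<^sup>+x. ennreal (- f x) \<partial>M) = ennreal q"
    "0 \<le> p" "0 \<le> q" "(\<integral>x. f x \<partial>M) = p - q"
    by (elim integrableE) auto
  then show ?thesis
    by (simp add: ereal_integral_def enn2ereal_ennreal)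
qed

lemma ereal_integral_mono:
  assumes "\<And>x. x \<in> space M \<Longrightarrow> f x \<le> g x"
  shows "ereal_integral M f \<le> ereal_integral M g"
proof -
  have mono: "enn2ereal a \<le> enn2ereal b" if "a \<le> b" for a b
    using that by (simp add: less_eq_ennreal.rep_eq)
  show ?thesis
    unfolding ereal_integral_def
    by (intro ereal_minus_mono mono nn_integral_mono e2ennreal_mono) (use assms in auto)
qed

lemma circle_mean_mono:
  assumes "\<And>t. u (a + of_real r * cis t) \<le> v (a + of_real r * cis t)"
  shows "circle_mean u a r \<le> circle_mean v a r"
  unfolding circle_mean_def
  by (intro ereal_mult_left_mono ereal_integral_mono assms) auto

lemma circle_mean_continuous:
  fixes \<phi> :: "complex \<Rightarrow> real"
  assumes "continuous_on {0..2*pi} (\<lambda>t. \<phi> (a + of_real r * cis t))"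
  shows "circle_mean (\<lambda>z. ereal (\<phi> z)) a r
    = ereal (integral {0..2*pi} (\<lambda>t. \<phi> (a + of_real r * cis t)) / (2*pi))"
proof -
  have si: "set_integrable lborel {0..2*pi} (\<lambda>t. \<phi> (a + of_real r * cis t))"
    by (rule borel_integrable_atLeastAtMost'[OF assms])
  then have "integrable (restrict_space lborel {0..2*pi}) (\<lambda>t. \<phi> (a + of_real r * cis t))"
    by (simp add: integrable_restrict_space set_integrable_def)
  then show ?thesis
    using set_borel_integral_eq_integral(2)[OF si]
    by (simp add: circle_mean_def ereal_integral_real integral_restrict_space set_lebesgue_integral_def)
qed

text \<open>The function \<open>z \<mapsto> 1 - w z\<close> maps the closed unit disc into the right half-plane, so that its
  principal logarithm is holomorphic there and has mean value \<open>Ln 1 = 0\<close>.\<close>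

lemma has_integral_ln_norm_circle:
  fixes w :: complex
  assumes "norm w < 1"
  shows "((\<lambda>t. ln ((norm (1 - w * cis t))\<^sup>2)) has_integral 0) {0..2*pi}"
proof -
  have re: "1 - w * z \<notin> \<real>\<^sub>\<le>\<^sub>0" if "norm z \<le> 1" for z
  proof -
    have "norm (w * z) \<le> norm w * 1" unfolding norm_mult using that by (intro mult_left_mono) auto
    then have "Re (w * z) < 1" using assms complex_Re_le_cmod[of "w * z"] by linarith
    then show ?thesis by (auto simp: complex_nonpos_Reals_iff)
  qed
  have hol: "(\<lambda>z. Ln (1 - w * z)) holomorphic_on cball 0 1"
    by (intro holomorphic_intros re) auto
  have "((\<lambda>t. Ln (1 - w * (0 + of_real 1 * cis t))) has_integral (2 * pi * Ln (1 - w * 0))) {0..2*pi}"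
    by (rule holomorphic_circle_mean[where f = "\<lambda>z. Ln (1 - w * z)"])
      (use hol holomorphic_on_imp_continuous_on holomorphic_on_subset[OF hol, of "ball 0 1"] in auto)
  then have "((\<lambda>t. Re (Ln (1 - w * cis t))) has_integral Re 0) {0..2*pi}"
    by (intro has_integral_linear[OF _ bounded_linear_Re, unfolded o_def]) simp
  then have "((\<lambda>t. 2 * Re (Ln (1 - w * cis t))) has_integral 2 * Re 0) {0..2*pi}"
    by (rule has_integral_mult_right)
  moreover have "2 * Re (Ln (1 - w * cis t)) = ln ((norm (1 - w * cis t))\<^sup>2)" for t
  proof -
    have "1 - w * cis t \<noteq> 0" using re[of "cis t"] by auto
    then show ?thesis by (simp add: ln_realpow)
  qed
  ultimately show ?thesis by simp
qed

lemma has_integral_ln_norm_sq: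
  fixes a :: complex
  assumes "0 \<le> r" "r < norm a"
  shows "((\<lambda>t. ln ((norm (a + of_real r * cis t))\<^sup>2)) has_integral (2 * pi * ln ((norm a)\<^sup>2))) {0..2*pi}"
proof -
  have a0: "a \<noteq> 0" using assms by auto
  define w where "w = - of_real r / a"
  have w: "norm w < 1" using assms a0 by (simp add: w_def norm_divide)
  have eq: "ln ((norm (a + of_real r * cis t))\<^sup>2) = ln ((norm a)\<^sup>2) + ln ((norm (1 - w * cis t))\<^sup>2)" for t
  proof -
    have "norm (w * cis t) < norm (1::complex)" using w by (simp add: norm_mult)
    then have n0: "1 - w * cis t \<noteq> 0" by auto
    have "a + of_real r * cis t = a * (1 - w * cis t)" using a0 by (simp add: w_def field_simps)
    then show ?thesis using n0 a0 by (simp add: norm_mult power_mult_distrib ln_mult)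
  qed
  have "((\<lambda>t. ln ((norm a)\<^sup>2) + ln ((norm (1 - w * cis t))\<^sup>2)) has_integral
      (2 * pi - 0) *\<^sub>R ln ((norm a)\<^sup>2) + 0) {0..2*pi}"
    by (intro has_integral_add has_integral_ln_norm_circle w has_integral_const_real[where a=0 and b="2*pi", simplified content_real] )
      (use has_integral_const_real[of "ln ((norm a)\<^sup>2)" 0 "2*pi"] in simp)
  then show ?thesis by (simp add: eq)
qed

lemma has_integral_norm_sq:
  fixes a :: complex
  shows "((\<lambda>t. (norm (a + of_real r * cis t))\<^sup>2) has_integral (2 * pi * ((norm a)\<^sup>2 + r\<^sup>2))) {0..2*pi}"
proof -
  have "((\<lambda>t. (\<lambda>z. cnj a * z) (0 + of_real 1 * cis t)) has_integral (2 * pi * (cnj a * 0))) {0..2*pi}"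
    by (rule holomorphic_circle_mean) (auto intro!: continuous_intros holomorphic_intros)
  then have "((\<lambda>t. Re (cnj a * cis t)) has_integral Re 0) {0..2*pi}"
    by (intro has_integral_linear[OF _ bounded_linear_Re, unfolded o_def]) simp
  then have "((\<lambda>t. 2 * r * Re (cnj a * cis t)) has_integral 2 * r * Re 0) {0..2*pi}"
    by (rule has_integral_mult_right)
  then have "((\<lambda>t. ((norm a)\<^sup>2 + r\<^sup>2) + 2 * r * Re (cnj a * cis t)) has_integral
      (2 * pi - 0) *\<^sub>R ((norm a)\<^sup>2 + r\<^sup>2) + 2 * r * Re 0) {0..2*pi}"
    using has_integral_const_real[of "(norm a)\<^sup>2 + r\<^sup>2" 0 "2*pi"] by (intro has_integral_add) auto
  moreover have "((norm a)\<^sup>2 + r\<^sup>2) + 2 * r * Re (cnj a * cis t) = (norm (a + of_real r * cis t))\<^sup>2" for t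
  proof -
    have "(norm (a + of_real r * cis t))\<^sup>2
      = (norm a)\<^sup>2 + (norm (of_real r * cis t))\<^sup>2 + 2 * r * Re (cnj a * cis t)"
      by (simp only: cmod_power2) (simp add: power2_eq_square algebra_simps)
    then show ?thesis by (simp add: norm_mult)
  qed
  ultimately show ?thesis by simp
qed

text \<open>Continuous real-valued subharmonic functions, with the means written as ordinary integrals. All
  the competitors that are constructed explicitly are of this kind; the extended real-valued notion
  is needed only for the supremum of all competitors.\<close>

definition submean :: "(complex \<Rightarrow> real) \<Rightarrow> bool" where
  "submean \<phi> \<longleftrightarrow> continuous_on UNIV \<phi> \<and>
     (\<forall>a r. r > 0 \<longrightarrow> 2 * pi * \<phi> a \<le> integral {0..2*pi} (\<lambda>t. \<phi> (a + of_real r * cis t)))"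

lemma continuous_on_circle:
  assumes "continuous_on UNIV \<phi>"
  shows "continuous_on A (\<lambda>t. \<phi> (a + of_real r * cis t))"
  by (intro continuous_on_compose2[OF assms] continuous_intros) auto

lemma integrable_on_circle:
  fixes \<phi> :: "complex \<Rightarrow> real"
  assumes "continuous_on UNIV \<phi>"
  shows "(\<lambda>t. \<phi> (a + of_real r * cis t)) integrable_on {0..2*pi}"
  by (intro integrable_continuous_real continuous_on_circle assms)

lemma submean_imp_subharmonic:
  assumes "submean \<phi>"
  shows "subharmonic (\<lambda>z. ereal (\<phi> z))"
  unfolding subharmonic_def
proof (intro conjI allI impI)
  have c: "continuous_on UNIV \<phi>" using assms by (simp add: submean_def)
  show "ereal (\<phi> z) < \<infinity>" for z by simp
  show "open {z. ereal (\<phi> z) < e}" for e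
    by (intro open_Collect_less continuous_on_ereal c continuous_on_const)
  fix a r assume r: "(r::real) > 0"
  have "2 * pi * \<phi> a \<le> integral {0..2*pi} (\<lambda>t. \<phi> (a + of_real r * cis t))"
    using assms r by (simp add: submean_def)
  then show "ereal (\<phi> a) \<le> circle_mean (\<lambda>z. ereal (\<phi> z)) a r"
    by (subst circle_mean_continuous[OF continuous_on_circle[OF c]]) (simp add: field_simps)
qed

lemma submean_const: "submean (\<lambda>_. c)"
  by (simp add: submean_def)

lemma submean_add:
  assumes "submean \<phi>" "submean \<psi>"
  shows "submean (\<lambda>z. \<phi> z + \<psi> z)"
proof -
  have c: "continuous_on UNIV \<phi>" "continuous_on UNIV \<psi>" using assms by (auto simp: submean_def)
  have "2 * pi * \<phi> a + 2 * pi * \<psi> a \<le> integral {0..2*pi} (\<lambda>t. \<phi> (a + of_real r * cis t)) + integral {0..2*pi} (\<lambda>t. \<psi> (a + of_real r * cis t))"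
    if "r > 0" for a r using assms that by (intro add_mono) (auto simp: submean_def)
  then show ?thesis
    using c by (auto simp: submean_def integral_add integrable_on_circle distrib_left intro!: continuous_intros)
qed

lemma submean_sum:
  assumes "\<And>i. i \<in> A \<Longrightarrow> submean (\<phi> i)"
  shows "submean (\<lambda>z. \<Sum>i\<in>A. \<phi> i z)"
  using assms by (induction A rule: infinite_finite_induct) (auto intro: submean_const submean_add)

lemma submean_scale:
  assumes "submean \<phi>" "c \<ge> 0"
  shows "submean (\<lambda>z. c * \<phi> z)"
  using assms mult_left_mono[OF _ assms(2)]
  by (fastforce simp: submean_def mult.left_commute intro!: continuous_intros)

lemma submean_max:
  assumes "submean \<phi>" "submean \<psi>"
  shows "submean (\<lambda>z. max (\<phi> z) (\<psi> z))"
proof -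
  have c: "continuous_on UNIV \<phi>" "continuous_on UNIV \<psi>" using assms by (auto simp: submean_def)
  then have cm: "continuous_on UNIV (\<lambda>z. max (\<phi> z) (\<psi> z))" by (intro continuous_intros)
  have "2 * pi * max (\<phi> a) (\<psi> a) \<le> integral {0..2*pi} (\<lambda>t. max (\<phi> (a + of_real r * cis t)) (\<psi> (a + of_real r * cis t)))" (is "_ \<le> ?I")
    if "r > 0" for a r
  proof -
    have "2 * pi * \<phi> a \<le> integral {0..2*pi} (\<lambda>t. \<phi> (a + of_real r * cis t))"
      "2 * pi * \<psi> a \<le> integral {0..2*pi} (\<lambda>t. \<psi> (a + of_real r * cis t))"
      using assms that by (auto simp: submean_def)
    moreover have "integral {0..2*pi} (\<lambda>t. \<phi> (a + of_real r * cis t)) \<le> ?I"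
      "integral {0..2*pi} (\<lambda>t. \<psi> (a + of_real r * cis t)) \<le> ?I"
      by (intro integral_le integrable_on_circle[OF cm] integrable_on_circle c; simp)+
    ultimately show ?thesis by (auto simp: max_def)
  qed
  then show ?thesis using cm by (simp add: submean_def)
qed

text \<open>With \<open>c = b - a\<close>, the restriction of \<open>|z - b|\<^sup>2 + \<delta>\<close> to the circle of radius \<open>r\<close> around \<open>a\<close> is
  \<open>S - 2 Re (r c\<^sup>* e\<^bsup>it\<^esup>)\<close> with \<open>S = r\<^sup>2 + |c|\<^sup>2 + \<delta>\<close>, and factors as \<open>x |1 - w e\<^bsup>it\<^esup>|\<^sup>2\<close> with \<open>|w| < 1\<close>, where
  \<open>x\<close> is the larger root of \<open>x\<^sup>2 - S x + r\<^sup>2 |c|\<^sup>2\<close>. So the mean of its logarithm is \<open>ln x\<close>, and the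
  quadratic is negative at \<open>|c|\<^sup>2 + \<delta>\<close>, which therefore lies below \<open>x\<close>. Taking \<open>\<delta> > 0\<close> avoids the
  integration of a singular logarithm over circles through \<open>b\<close>.\<close>

lemma submean_ln:
  fixes b :: complex
  assumes \<delta>: "\<delta> > 0"
  shows "submean (\<lambda>z. ln ((norm (z - b))\<^sup>2 + \<delta>))"
  unfolding submean_def
proof (intro conjI allI impI)
  have pos: "(norm (z - b))\<^sup>2 + \<delta> > 0" for z
    using \<delta> zero_le_power2[of "norm (z - b)"] by linarith
  then show "continuous_on UNIV (\<lambda>z. ln ((norm (z - b))\<^sup>2 + \<delta>))"
    by (intro continuous_intros) (auto simp: less_imp_neq[symmetric])
  fix a :: complex and r :: real assume r: "r > 0"
  define c where "c = b - a"
  define S where "S = r\<^sup>2 + (norm c)\<^sup>2 + \<delta>"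
  define p where "p = r * norm c"
  have p0: "p \<ge> 0" using r by (simp add: p_def)
  have "0 \<le> (r - norm c)\<^sup>2" by simp
  then have Sp: "S > 2 * p" using \<delta> by (simp add: S_def p_def power2_eq_square algebra_simps)
  define D where "D = sqrt (S\<^sup>2 - 4 * p\<^sup>2)"
  have "(2 * p)\<^sup>2 \<le> S\<^sup>2" using Sp p0 by (intro power_mono) auto
  then have D: "D \<ge> 0" "D\<^sup>2 = S\<^sup>2 - 4 * p\<^sup>2" by (auto simp: D_def power_mult_distrib)
  define x where "x = (S + D) / 2"
  have xp: "x > p" using Sp D by (simp add: x_def)
  then have x0: "x > 0" using p0 by linarith
  have xeq: "x * x + p * p = S * x"
    using D(2) by (simp add: x_def power2_eq_square field_simps)
  define y where "y = (norm c)\<^sup>2 + \<delta>"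
  have yx: "y \<le> x"
  proof (rule ccontr)
    assume "\<not> y \<le> x"
    then have "y > x" by simp
    have "x * (y * y + p * p) - x * (S * y) = (y - x) * (x * y - p * p)"
      using xeq by (simp add: algebra_simps) (metis mult.assoc mult.commute distrib_left)
    moreover have "p * p \<le> x * y" using xp \<open>y > x\<close> p0 by (intro mult_mono) auto
    ultimately have "0 \<le> x * (y * y + p * p) - x * (S * y)" using \<open>y > x\<close> by simp
    then have "x * (S * y) \<le> x * (y * y + p * p)" by simp
    then have "S * y \<le> y * y + p * p" using x0 by simp
    moreover have "S * y = y * y + p * p + r\<^sup>2 * \<delta>"
      by (simp add: S_def y_def p_def power2_eq_square algebra_simps)
    ultimately show False using r \<delta> by (simp add: mult_le_0_iff)
  qed
  define w where "w = of_real r * cnj c / of_real x"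
  have nw: "norm w = p / x" using r x0 by (simp add: w_def p_def norm_mult norm_divide)
  then have w1: "norm w < 1" using xp x0 by simp
  have eq: "(norm (a + of_real r * cis t - b))\<^sup>2 + \<delta> = x * (norm (1 - w * cis t))\<^sup>2" for t
  proof -
    have cs: "(cos t)\<^sup>2 + (sin t)\<^sup>2 = 1" by simp
    have 1: "(norm (1 - w * cis t))\<^sup>2 = 1 + (norm w)\<^sup>2 - 2 * Re (w * cis t)"
    proof -
      have "(norm (1 - w * cis t))\<^sup>2 = 1 + (norm (w * cis t))\<^sup>2 - 2 * Re (w * cis t)"
        by (simp only: cmod_power2) (simp add: power2_eq_square algebra_simps)
      then show ?thesis by (simp add: norm_mult)
    qed
    have 2: "(norm (of_real r * cis t - c))\<^sup>2 = r\<^sup>2 + (norm c)\<^sup>2 - 2 * Re (of_real r * cnj c * cis t)"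
    proof -
      have "(norm (of_real r * cis t - c))\<^sup>2 = (norm (of_real r * cis t))\<^sup>2 + (norm c)\<^sup>2 - 2 * Re (of_real r * cnj c * cis t)"
        by (simp only: cmod_power2) (simp add: power2_eq_square algebra_simps)
      then show ?thesis by (simp add: norm_mult)
    qed
    have "x * (1 + (norm w)\<^sup>2) = S"
      using xeq x0 unfolding nw by (simp add: power2_eq_square field_simps)
    moreover have "x * Re (w * cis t) = Re (of_real r * cnj c * cis t)"
      using x0 by (simp add: w_def)
    ultimately have "x * (norm (1 - w * cis t))\<^sup>2 = S - 2 * Re (of_real r * cnj c * cis t)"
      unfolding 1 by (simp only: right_diff_distrib mult.left_commute[of x 2])
    moreover have "a + of_real r * cis t - b = of_real r * cis t - c" by (simp add: c_def)
    ultimately show ?thesis using 2 unfolding S_def by (simp only:)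
  qed
  have ln_eq: "ln ((norm (a + of_real r * cis t - b))\<^sup>2 + \<delta>) = ln x + ln ((norm (1 - w * cis t))\<^sup>2)" for t
  proof -
    have "norm (w * cis t) < norm (1::complex)" using w1 by (simp add: norm_mult)
    then have "1 - w * cis t \<noteq> 0" by auto
    then show ?thesis unfolding eq using x0 by (simp add: ln_mult)
  qed
  have "((\<lambda>t. ln x + ln ((norm (1 - w * cis t))\<^sup>2)) has_integral (2 * pi - 0) *\<^sub>R ln x + 0) {0..2*pi}"
    using has_integral_const_real[of "ln x" 0 "2*pi"] by (intro has_integral_add has_integral_ln_norm_circle w1) auto
  then have "integral {0..2*pi} (\<lambda>t. ln ((norm (a + of_real r * cis t - b))\<^sup>2 + \<delta>)) = 2 * pi * ln x"
    unfolding ln_eq by (simp add: integral_unique)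
  moreover have "ln y \<le> ln x" using yx x0 \<delta> by (simp add: y_def add_nonneg_pos)
  ultimately show "2 * pi * ln ((norm (a - b))\<^sup>2 + \<delta>) \<le> integral {0..2*pi} (\<lambda>t. ln ((norm (a + of_real r * cis t - b))\<^sup>2 + \<delta>))"
    by (simp add: y_def c_def norm_minus_commute)
qed

section \<open>The maximum principle in the exterior of the unit disc\<close>

lemma continuous_compact_abs_bound:
  fixes f :: "complex \<Rightarrow> real"
  assumes "continuous_on S f" "compact S"
  obtains B where "B \<ge> 0" "\<And>z. z \<in> S \<Longrightarrow> \<bar>f z\<bar> \<le> B"
proof -
  have "bounded (f ` S)"
    by (intro compact_imp_bounded compact_continuous_image assms)
  then obtain B where B: "\<And>z. z \<in> S \<Longrightarrow> \<bar>f z\<bar> \<le> B"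
    unfolding bounded_iff by auto
  show thesis by (rule that[of "max B 0"]) (auto intro: le_max_iff_disj[THEN iffD2] B)
qed

lemma open_less_continuous:
  fixes u :: "complex \<Rightarrow> ereal"
  assumes u: "\<And>c. open {z. u z < c}" and g: "continuous_on UNIV g"
  shows "open {z. u z < ereal (g z)}"
proof -
  have "{z. u z < ereal (g z)} = (\<Union>q::real. {z. u z < ereal q} \<inter> {z. q < g z})"
  proof (intro set_eqI iffI)
    fix z assume "z \<in> {z. u z < ereal (g z)}"
    then obtain q where "u z < ereal q" "ereal q < ereal (g z)" using ereal_dense2 by blast
    then show "z \<in> (\<Union>q::real. {z. u z < ereal q} \<inter> {z. q < g z})" by auto
  qed (auto intro: less_trans)
  moreover have "open ({z. u z < ereal q} \<inter> {z. q < g z})" for q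
    by (intro open_Int u open_Collect_less g continuous_intros)
  ultimately show ?thesis by auto
qed

text \<open>If no point were maximal, the sets \<open>{z. f z < f y}\<close> would cover \<open>A\<close>; the largest of the values
  \<open>f y\<close> belonging to a finite subcover would then be exceeded.\<close>

lemma usc_attains_sup:
  fixes f :: "'a::topological_space \<Rightarrow> 'b::linorder"
  assumes "compact A" "A \<noteq> {}" and op: "\<And>y. y \<in> A \<Longrightarrow> open {z. f z < f y}"
  shows "\<exists>x\<in>A. \<forall>y\<in>A. f y \<le> f x"
proof (rule ccontr)
  assume "\<not> (\<exists>x\<in>A. \<forall>y\<in>A. f y \<le> f x)"
  then have cov: "A \<subseteq> (\<Union>y\<in>A. {z. f z < f y})" by (force simp: not_le)
  obtain Y where Y: "Y \<subseteq> A" "finite Y" "A \<subseteq> (\<Union>y\<in>Y. {z. f z < f y})"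
    using compactE_image[OF \<open>compact A\<close> op cov] by blast
  have "Y \<noteq> {}" using Y(3) \<open>A \<noteq> {}\<close> by auto
  then obtain x where x: "x \<in> Y" "f x = Max (f ` Y)"
    using Max_in[of "f ` Y"] Y(2) by fastforce
  obtain y where y: "y \<in> Y" "f x < f y" using x Y by blast
  have "f y \<le> f x" unfolding x(2) using y(1) Y(2) by (intro Max_ge) auto
  with y(2) show False by simp
qed

text \<open>Comparison with the strictly superharmonic function
  \<open>\<phi>(z) = M + (1 + \<delta>) ln |z|\<^sup>2 + \<eta> (\<rho>\<^sup>2 - |z|\<^sup>2)\<close> on the annulus \<open>1 \<le> |z| \<le> \<rho>\<close>. The term with \<open>\<delta>\<close> makes \<open>\<phi>\<close>
  dominate \<open>u\<close> on the outer circle if \<open>\<rho>\<close> is large, and the one with \<open>\<eta>\<close> makes the mean value of \<open>\<phi>\<close>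
  over small circles strictly smaller than the value at the centre, which excludes an interior
  maximum of \<open>u - \<phi>\<close>. Both \<open>\<delta>\<close> and \<open>\<eta>\<close> are so small that a violation of the bound at \<open>z1\<close>
  remains a violation of \<open>u \<le> \<phi>\<close>.\<close>

lemma subharmonic_exterior_bound:
  assumes u: "subharmonic u"
    and growth: "\<forall>\<^sub>F z in at_infinity. u z \<le> ereal (ln ((norm z)\<^sup>2) + B)"
    and M: "\<And>z. norm z = 1 \<Longrightarrow> u z \<le> ereal M" and z1: "norm z1 \<ge> 1"
  shows "u z1 \<le> ereal (M + ln ((norm z1)\<^sup>2))"
proof (rule ccontr)
  assume "\<not> ?thesis"
  then have gt: "u z1 > ereal (M + ln ((norm z1)\<^sup>2))" by simp
  have ufin: "u z < \<infinity>" and uopen: "open {z. u z < c}" for z c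
    using u by (auto simp: subharmonic_def)
  obtain y where y: "u z1 = ereal y"
    using ufin[of z1] gt by (cases "u z1") auto
  define L where "L = ln ((norm z1)\<^sup>2)"
  have L: "L \<ge> 0" using z1 by (simp add: L_def)
  define \<gamma> where "\<gamma> = y - (M + L)"
  have \<gamma>: "\<gamma> > 0" using gt by (simp add: y \<gamma>_def L_def)
  define \<delta> where "\<delta> = \<gamma> / (3 * (L + 1))"
  have \<delta>: "\<delta> > 0" using \<gamma> L by (simp add: \<delta>_def)
  have \<delta>L: "\<delta> * L \<le> \<gamma> / 3" using \<gamma> L by (simp add: \<delta>_def field_simps)
  obtain R0 where R0: "\<And>z. norm z \<ge> R0 \<Longrightarrow> u z \<le> ereal (ln ((norm z)\<^sup>2) + B)"
    using growth by (auto simp: eventually_at_infinity)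
  define \<rho> where "\<rho> = max (max R0 (norm z1 + 1)) (exp (\<bar>B - M\<bar> / \<delta>))"
  have \<rho>: "\<rho> \<ge> R0" "\<rho> \<ge> norm z1 + 1" "\<rho> \<ge> exp (\<bar>B - M\<bar> / \<delta>)" by (auto simp: \<rho>_def)
  have \<rho>1: "\<rho> > 1" using \<rho>(2) z1 by linarith
  have ln\<rho>: "\<bar>B - M\<bar> \<le> \<delta> * ln (\<rho>\<^sup>2)"
  proof -
    have "\<bar>B - M\<bar> / \<delta> \<le> ln \<rho>" using \<rho>(3) \<rho>1 by (simp add: ln_ge_iff)
    moreover have "ln \<rho> \<le> ln (\<rho>\<^sup>2)" using \<rho>1 by (simp add: power2_eq_square)
    ultimately have "\<bar>B - M\<bar> / \<delta> \<le> ln (\<rho>\<^sup>2)" by linarith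
    then show ?thesis using \<delta> by (simp add: field_simps)
  qed
  define \<eta> where "\<eta> = \<gamma> / (3 * \<rho>\<^sup>2)"
  have \<eta>: "\<eta> > 0" "\<eta> * \<rho>\<^sup>2 = \<gamma> / 3" using \<gamma> \<rho>1 by (auto simp: \<eta>_def)
  \<comment> \<open>The maximum only serves to make \<open>\<phi>\<close> continuous at 0.\<close>
  define \<phi> where "\<phi> = (\<lambda>z::complex. M + (1 + \<delta>) * ln (max 1 ((norm z)\<^sup>2)) + \<eta> * (\<rho>\<^sup>2 - (norm z)\<^sup>2))"
  have \<phi>: "\<phi> z = M + (1 + \<delta>) * ln ((norm z)\<^sup>2) + \<eta> * (\<rho>\<^sup>2 - (norm z)\<^sup>2)" if "norm z \<ge> 1" for z
    using that by (simp add: \<phi>_def max_def)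
  have c\<phi>: "continuous_on UNIV \<phi>"
    unfolding \<phi>_def by (intro continuous_intros) (auto simp: max_def)
  define A where "A = {z::complex. 1 \<le> norm z \<and> norm z \<le> \<rho>}"
  have "A = cball 0 \<rho> \<inter> {z. 1 \<le> norm z}" by (auto simp: A_def)
  then have "compact A"
    by (simp add: compact_Int_closed closed_Collect_le continuous_on_norm_id)
  have z1A: "z1 \<in> A" using z1 \<rho> by (auto simp: A_def)
  define f where "f = (\<lambda>z. u z - ereal (\<phi> z))"
  have fl: "f z < ereal c \<longleftrightarrow> u z < ereal (\<phi> z + c)" for z c
    using ufin[of z] by (cases "u z") (auto simp: f_def)
  have "open {z. f z < f y}" for y
  proof (cases "f y")
    case (real c)
    then show ?thesis unfolding fl by (auto simp: fl intro!: open_less_continuous uopen continuous_intros c\<phi>)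
  next
    case PInf
    then show ?thesis using ufin[of y] by (cases "u y") (auto simp: f_def)
  qed auto
  then obtain b where b: "b \<in> A" "\<And>y. y \<in> A \<Longrightarrow> f y \<le> f b"
    using usc_attains_sup[OF \<open>compact A\<close>, of f] z1A by auto
  have "\<phi> z1 < y"
  proof -
    have "\<phi> z1 = M + (1 + \<delta>) * L + \<eta> * (\<rho>\<^sup>2 - (norm z1)\<^sup>2)" using \<phi>[OF z1] by (simp add: L_def)
    also have "\<dots> \<le> M + L + \<gamma> / 3 + \<gamma> / 3" 
    proof -
      have "\<eta> * (\<rho>\<^sup>2 - (norm z1)\<^sup>2) \<le> \<gamma> / 3" using \<eta> by (simp add: right_diff_distrib)
      moreover have "(1 + \<delta>) * L \<le> L + \<gamma> / 3" using \<delta>L by (simp add: distrib_right)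
      ultimately show ?thesis by linarith
    qed
    also have "\<dots> < y" using \<gamma> \<gamma>_def by linarith
    finally show ?thesis .
  qed
  then have "f z1 > 0" by (simp add: f_def y)
  then have fb: "f b > 0" using b(2)[OF z1A] by simp
  then obtain k where k: "f b = ereal k" "k > 0"
    using ufin[of b] by (cases "u b") (auto simp: f_def)
  have ub: "u b = ereal (\<phi> b + k)" using k by (cases "u b") (auto simp: f_def)
  have b1: "norm b \<noteq> 1"
  proof
    assume "norm b = 1"
    then have "u b \<le> ereal M" "\<phi> b \<ge> M" using M \<phi>[of b] \<rho>1 \<eta> by auto
    then show False using ub k by simp
  qed
  have b2: "norm b \<noteq> \<rho>"
  proof
    assume nb: "norm b = \<rho>"
    then have "u b \<le> ereal (ln (\<rho>\<^sup>2) + B)" using R0[of b] \<rho> by simp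
    moreover have "\<phi> b = M + (1 + \<delta>) * ln (\<rho>\<^sup>2)" using \<phi>[of b] \<rho>1 nb by simp
    ultimately show False using ub k ln\<rho> by (simp add: algebra_simps)
  qed
  have b3: "1 < norm b" "norm b < \<rho>" using b(1) b1 b2 by (auto simp: A_def)
  define r where "r = min (norm b - 1) (\<rho> - norm b)"
  have r: "r > 0" "r < norm b" using b3 by (auto simp: r_def)
  have circ: "1 \<le> norm (b + of_real r * cis t)" "norm (b + of_real r * cis t) \<le> \<rho>" for t
  proof -
    have n: "norm (of_real r * cis t) = r" using r by (simp add: norm_mult)
    have "norm b \<le> norm (b + of_real r * cis t) + r"
      using norm_triangle_ineq4[of "b + of_real r * cis t" "of_real r * cis t"] n by simp
    then show "1 \<le> norm (b + of_real r * cis t)" by (simp add: r_def min_def split: if_splits)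
    have "norm (b + of_real r * cis t) \<le> norm b + r"
      using norm_triangle_ineq[of b "of_real r * cis t"] n by simp
    then show "norm (b + of_real r * cis t) \<le> \<rho>" by (simp add: r_def min_def split: if_splits)
  qed
  have le: "u (b + of_real r * cis t) \<le> ereal (\<phi> (b + of_real r * cis t) + k)" for t
  proof -
    have "f (b + of_real r * cis t) \<le> ereal k"
      using b(2)[of "b + of_real r * cis t"] circ k by (simp add: A_def)
    then show ?thesis by (cases "u (b + of_real r * cis t)") (auto simp: f_def)
  qed
  have "u b \<le> circle_mean u b r" using u r by (simp add: subharmonic_def)
  also have "\<dots> \<le> circle_mean (\<lambda>z. ereal (\<phi> z + k)) b r" by (intro circle_mean_mono le)
  also have "\<dots> = ereal (integral {0..2*pi} (\<lambda>t. \<phi> (b + of_real r * cis t) + k) / (2 * pi))"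
    by (intro circle_mean_continuous continuous_on_circle continuous_intros c\<phi>)
  also have "integral {0..2*pi} (\<lambda>t. \<phi> (b + of_real r * cis t) + k)
     = 2 * pi * (\<phi> b + k - \<eta> * r\<^sup>2)"
  proof -
    have "((\<lambda>t. (M + k + \<eta> * \<rho>\<^sup>2) + ((1 + \<delta>) * ln ((norm (b + of_real r * cis t))\<^sup>2)
        - \<eta> * (norm (b + of_real r * cis t))\<^sup>2)) has_integral
      ((2 * pi - 0) *\<^sub>R (M + k + \<eta> * \<rho>\<^sup>2) + ((1 + \<delta>) * (2 * pi * ln ((norm b)\<^sup>2)) - \<eta> * (2 * pi * ((norm b)\<^sup>2 + r\<^sup>2))))) {0..2*pi}"
      using has_integral_const_real[of "M + k + \<eta> * \<rho>\<^sup>2" 0 "2*pi"] r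
      by (intro has_integral_add has_integral_diff has_integral_mult_right has_integral_ln_norm_sq has_integral_norm_sq) auto
    moreover have "(M + k + \<eta> * \<rho>\<^sup>2) + ((1 + \<delta>) * ln ((norm (b + of_real r * cis t))\<^sup>2)
        - \<eta> * (norm (b + of_real r * cis t))\<^sup>2) = \<phi> (b + of_real r * cis t) + k" for t
      using \<phi>[OF circ(1)[of t]] by (simp add: algebra_simps)
    ultimately have "integral {0..2*pi} (\<lambda>t. \<phi> (b + of_real r * cis t) + k) =
      (2 * pi - 0) *\<^sub>R (M + k + \<eta> * \<rho>\<^sup>2) + ((1 + \<delta>) * (2 * pi * ln ((norm b)\<^sup>2)) - \<eta> * (2 * pi * ((norm b)\<^sup>2 + r\<^sup>2)))"
      by (simp only: integral_unique)
    moreover have "\<phi> b + k - \<eta> * r\<^sup>2 =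
      (M + k + \<eta> * \<rho>\<^sup>2) + ((1 + \<delta>) * ln ((norm b)\<^sup>2) - \<eta> * ((norm b)\<^sup>2 + r\<^sup>2))"
      using \<phi>[of b] b3 by (simp add: algebra_simps)
    ultimately show ?thesis
      by (simp only:) (simp add: algebra_simps)
  qed
  finally have "\<phi> b + k \<le> \<phi> b + k - \<eta> * r\<^sup>2" by (simp add: ub)
  moreover have "\<eta> * r\<^sup>2 > 0" using \<eta> r by simp
  ultimately show False by linarith
qed

section \<open>Suprema of families of subharmonic functions\<close>

text \<open>Expresses the integral of a function bounded above through that of a nonnegative function, to
  which Fatou's lemma applies.\<close>

lemma ereal_integral_bounded_above:
  assumes f[measurable]: "f \<in> borel_measurable M" and "finite_measure M"
    and fK: "\<And>x. x \<in> space M \<Longrightarrow> f x \<le> ereal K" and K: "K \<ge> 0"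
  shows "ereal_integral M f
    = ereal (K * measure M (space M)) - enn2ereal (\<integral>\<^sup>+x. e2ennreal (ereal K - f x) \<partial>M)"
proof -
  interpret finite_measure M by fact
  define P where "P = (\<integral>\<^sup>+x. e2ennreal (f x) \<partial>M)"
  define N where "N = (\<integral>\<^sup>+x. e2ennreal (- f x) \<partial>M)"
  define D where "D = (\<integral>\<^sup>+x. e2ennreal (ereal K - f x) \<partial>M)"
  have pw: "e2ennreal (ereal K - f x) + e2ennreal (f x) = ennreal K + e2ennreal (- f x)"
    if "x \<in> space M" for x
  proof (cases "f x")
    case (real y)
    have "ennreal (K - y) + ennreal y = ennreal K + ennreal (- y)"
    proof (cases "y \<ge> 0")
      case True
      then show ?thesis using fK[OF that] real by (simp add: ennreal_plus[symmetric] ennreal_neg del: ennreal_plus)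
    next
      case False
      then show ?thesis using K by (simp add: ennreal_plus[symmetric] ennreal_neg del: ennreal_plus)
    qed
    then show ?thesis using real by simp
  qed (use fK[OF that] in auto)
  have "D + P = (\<integral>\<^sup>+x. e2ennreal (ereal K - f x) + e2ennreal (f x) \<partial>M)"
    unfolding D_def P_def by (subst nn_integral_add) auto
  also have "\<dots> = (\<integral>\<^sup>+x. ennreal K + e2ennreal (- f x) \<partial>M)"
    by (intro nn_integral_cong pw)
  also have "\<dots> = ennreal K * emeasure M (space M) + N"
    unfolding N_def by (subst nn_integral_add) auto
  also have "ennreal K * emeasure M (space M) = ennreal (K * measure M (space M))"
    using K by (simp add: emeasure_eq_measure ennreal_mult)
  finally have DP: "D + P = ennreal (K * measure M (space M)) + N" .
  have "P \<le> (\<integral>\<^sup>+x. ennreal K \<partial>M)"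
    unfolding P_def by (intro nn_integral_mono) (use fK e2ennreal_mono in fastforce)
  also have "\<dots> < \<infinity>"
    by (simp add: ennreal_mult_eq_top_iff less_top[symmetric])
  finally obtain p where p: "P = ennreal p" "p \<ge> 0" by (cases P) auto
  have K\<mu>: "K * measure M (space M) \<ge> 0" using K by simp
  have "enn2ereal P - enn2ereal N = ereal (K * measure M (space M)) - enn2ereal D"
  proof (cases N)
    case (real n)
    then have "D + ennreal p = ennreal (K * measure M (space M) + n)"
      using DP p K\<mu> by simp
    then obtain d where d: "D = ennreal d" "d \<ge> 0" by (cases D) auto
    then have "d + p = K * measure M (space M) + n"
      using \<open>D + ennreal p = _\<close> p real K\<mu> by (simp add: ennreal_plus[symmetric] del: ennreal_plus)
    then show ?thesis using p d real by (simp add: enn2ereal_ennreal)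
  next
    case top
    then have "D = top" using DP p by (cases D) (auto simp: ennreal_plus[symmetric] simp del: ennreal_plus)
    then show ?thesis using top p by (simp add: enn2ereal_ennreal)
  qed
  then show ?thesis by (simp add: ereal_integral_def P_def N_def D_def)
qed

lemma less_e2ennreal_diff_iff:
  "y < e2ennreal (ereal K - s) \<longleftrightarrow> s < ereal K - enn2ereal y"
proof (cases y)
  case (real r)
  show ?thesis
  proof (cases s)
    case (real x)
    have "ennreal r < ennreal (K - x) \<longleftrightarrow> r < K - x"
      using \<open>0 \<le> r\<close> by (simp add: ennreal_less_iff)
    then show ?thesis using \<open>y = _\<close> \<open>0 \<le> r\<close> real by (auto simp: enn2ereal_ennreal)
  qed (use \<open>y = _\<close> \<open>0 \<le> r\<close> in \<open>auto simp: enn2ereal_ennreal e2ennreal_neg\<close>)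
qed (cases s; simp)

definition circle_deficit :: "(complex \<Rightarrow> ereal) \<Rightarrow> real \<Rightarrow> complex \<Rightarrow> real \<Rightarrow> ennreal" where
  "circle_deficit u K a r =
     (\<integral>\<^sup>+t. e2ennreal (ereal K - u (a + of_real r * cis t)) \<partial>restrict_space lborel {0..2*pi})"

lemma borel_measurable_usc:
  fixes u :: "complex \<Rightarrow> ereal"
  assumes u: "\<And>c. open {z. u z < c}"
  shows "u \<in> borel_measurable borel"
proof (rule borel_measurableI_less)
  fix c show "{z \<in> space borel. u z < c} \<in> sets borel" using u[of c] by simp
qed

lemma circle_mean_ge_iff:
  fixes u :: "complex \<Rightarrow> ereal"
  assumes u: "\<And>c. open {z. u z < c}" and K: "K \<ge> 0"
    and le: "\<And>t. u (a + of_real r * cis t) \<le> ereal K"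
  shows "ereal c \<le> circle_mean u a r \<longleftrightarrow> enn2ereal (circle_deficit u K a r) \<le> ereal (2 * pi * (K - c))"
proof -
  let ?M = "restrict_space lborel {0..2*pi}"
  have um[measurable]: "u \<in> borel_measurable borel" by (rule borel_measurable_usc[OF u])
  have [measurable]: "(\<lambda>t. a + of_real r * cis t) \<in> borel_measurable borel"
    by (intro borel_measurable_continuous_onI continuous_intros)
  have meas: "(\<lambda>t. u (a + of_real r * cis t)) \<in> borel_measurable ?M"
    by (rule measurable_restrict_space1) simp
  have fin: "finite_measure ?M"
    by (rule finite_measureI) (simp add: emeasure_restrict_space space_restrict_space)
  have "measure ?M (space ?M) = 2 * pi"
    by (simp add: measure_restrict_space space_restrict_space)
  then have "circle_mean u a r = ereal (1 / (2 * pi)) * (ereal (K * (2 * pi)) - enn2ereal (circle_deficit u K a r))"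
    unfolding circle_mean_def circle_deficit_def
    using ereal_integral_bounded_above[OF meas fin le K] by simp
  then show ?thesis
    by (cases "circle_deficit u K a r") (auto simp: enn2ereal_ennreal field_simps)
qed

text \<open>Semicontinuity of circle means in the centre, by Fatou's lemma.\<close>

lemma circle_deficit_Liminf:
  fixes u :: "complex \<Rightarrow> ereal"
  assumes u: "\<And>c. open {z. u z < c}" and b: "b \<longlonglongrightarrow> a"
  shows "circle_deficit u K a r \<le> liminf (\<lambda>n. circle_deficit u K (b n) r)"
proof -
  have um[measurable]: "u \<in> borel_measurable borel" by (rule borel_measurable_usc[OF u])
  have pw: "e2ennreal (ereal K - u (a + of_real r * cis t))
      \<le> liminf (\<lambda>n. e2ennreal (ereal K - u (b n + of_real r * cis t)))" for t
    unfolding le_Liminf_iff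
  proof (intro allI impI)
    fix y assume "y < e2ennreal (ereal K - u (a + of_real r * cis t))"
    then have "a + of_real r * cis t \<in> {z. u z < ereal K - enn2ereal y}"
      by (simp add: less_e2ennreal_diff_iff)
    moreover have "(\<lambda>n. b n + of_real r * cis t) \<longlonglongrightarrow> a + of_real r * cis t"
      by (intro tendsto_intros b)
    ultimately have "\<forall>\<^sub>F n in sequentially. b n + of_real r * cis t \<in> {z. u z < ereal K - enn2ereal y}"
      using u topological_tendstoD by blast
    then show "\<forall>\<^sub>F n in sequentially. y < e2ennreal (ereal K - u (b n + of_real r * cis t))"
      by (simp add: less_e2ennreal_diff_iff)
  qed
  have meas: "(\<lambda>t. e2ennreal (ereal K - u (b n + of_real r * cis t))) \<in> borel_measurable (restrict_space lborel {0..2*pi})" for n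
  proof -
    have [measurable]: "(\<lambda>t. b n + of_real r * cis t) \<in> borel_measurable borel"
      by (intro borel_measurable_continuous_onI continuous_intros)
    show ?thesis by (rule measurable_restrict_space1) simp
  qed
  have "circle_deficit u K a r \<le> (\<integral>\<^sup>+t. liminf (\<lambda>n. e2ennreal (ereal K - u (b n + of_real r * cis t))) \<partial>restrict_space lborel {0..2*pi})"
    unfolding circle_deficit_def by (intro nn_integral_mono pw)
  also have "\<dots> \<le> liminf (\<lambda>n. circle_deficit u K (b n) r)"
    unfolding circle_deficit_def by (intro nn_integral_liminf meas)
  finally show ?thesis .
qed

definition usc_reg :: "(complex \<Rightarrow> ereal) \<Rightarrow> complex \<Rightarrow> ereal" where
  "usc_reg v z = (INF U\<in>{U. open U \<and> z \<in> U}. SUP y\<in>U. v y)"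

lemma usc_reg_ge: "v z \<le> usc_reg v z"
  unfolding usc_reg_def by (intro INF_greatest) (auto intro: SUP_upper)

lemma usc_reg_le:
  assumes "open U" "z \<in> U" "\<And>y. y \<in> U \<Longrightarrow> v y \<le> c"
  shows "usc_reg v z \<le> c"
  unfolding usc_reg_def using assms by (intro INF_lower2[of U] SUP_least) auto

lemma usc_reg_less_open: "open {z. usc_reg v z < c}"
proof (subst open_subopen, intro ballI)
  fix z assume "z \<in> {z. usc_reg v z < c}"
  then obtain U where U: "open U" "z \<in> U" "(SUP y\<in>U. v y) < c"
    by (auto simp: usc_reg_def INF_less_iff)
  have "usc_reg v y < c" if "y \<in> U" for y
    using usc_reg_le[OF U(1) that, of v "SUP y\<in>U. v y"] U(3) SUP_upper[of _ U v] by (meson le_less_trans)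
  then show "\<exists>T. open T \<and> z \<in> T \<and> T \<subseteq> {z. usc_reg v z < c}" using U by blast
qed

lemma usc_reg_le_continuous:
  assumes S: "open S" and g: "continuous_on S g" and le: "\<And>y. y \<in> S \<Longrightarrow> v y \<le> ereal (g y)" and z: "z \<in> S"
  shows "usc_reg v z \<le> ereal (g z)"
proof (rule ccontr)
  assume "\<not> usc_reg v z \<le> ereal (g z)"
  then obtain c where c: "ereal (g z) < ereal c" "ereal c < usc_reg v z"
    by (meson ereal_dense2 not_le)
  have "open (S \<inter> g -` {..<c})"
    using S g by (simp add: continuous_on_open_vimage Int_commute)
  moreover have "v y \<le> ereal c" if "y \<in> S \<inter> g -` {..<c}" for y
    using that le[of y] by (auto intro: order_trans)
  ultimately have "usc_reg v z \<le> ereal c"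
    using z c(1) by (intro usc_reg_le[of "S \<inter> g -` {..<c}"]) auto
  then show False using c(2) by simp
qed

text \<open>Every member of the family lies below its mean, hence below the mean of the regularization \<open>V\<close>.
  As the mean of \<open>V\<close> is upper semicontinuous in the centre, a strict inequality
  \<open>circle_mean V a r < c\<close> extends to a neighbourhood of \<open>a\<close>; there the supremum of the family is at
  most \<open>c\<close>, and so is \<open>V a\<close>.\<close>

lemma usc_reg_Sup_submean:
  assumes F: "\<And>u. u \<in> F \<Longrightarrow> subharmonic u"
    and g: "continuous_on UNIV g" and le: "\<And>u z. u \<in> F \<Longrightarrow> u z \<le> ereal (g z)" and r: "r > 0"
  defines "V \<equiv> usc_reg (\<lambda>z. SUP u\<in>F. u z)"
  shows "V a \<le> circle_mean V a r"
proof (rule ccontr)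
  assume "\<not> V a \<le> circle_mean V a r"
  then obtain c where c: "circle_mean V a r < ereal c" "ereal c < V a"
    by (meson ereal_dense2 not_le)
  have op: "open {z. V z < c}" for c unfolding V_def by (rule usc_reg_less_open)
  have Vg: "V z \<le> ereal (g z)" for z
    unfolding V_def by (rule usc_reg_le_continuous[of UNIV]) (auto intro: SUP_least le g)
  obtain K where K: "K \<ge> 0" and K0: "\<And>z. z \<in> cball a (r + 1) \<Longrightarrow> \<bar>g z\<bar> \<le> K"
    using continuous_compact_abs_bound[OF continuous_on_subset[OF g] compact_cball] by blast
  have VK: "V (b + of_real r * cis t) \<le> ereal K" if "b \<in> ball a 1" for b t
  proof -
    have "norm (b + of_real r * cis t - a) \<le> norm (b - a) + norm (of_real r * cis t)"
      by (metis add_diff_eq add.commute diff_add_eq norm_triangle_ineq)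
    also have "\<dots> \<le> r + 1" using that r by (simp add: norm_mult dist_norm norm_minus_commute)
    finally have "b + of_real r * cis t \<in> cball a (r + 1)" by (simp add: dist_norm norm_minus_commute)
    then have "g (b + of_real r * cis t) \<le> K" using K0 by force
    then show ?thesis using Vg by (meson ereal_less_eq(3) order_trans)
  qed
  have "\<exists>d. 0 < d \<and> d \<le> 1 \<and> (\<forall>b\<in>ball a d. circle_mean V b r < ereal c)"
  proof (rule ccontr)
    assume neg: "\<not> ?thesis"
    have "\<exists>b. b \<in> ball a (1 / Suc n) \<and> ereal c \<le> circle_mean V b r" for n :: nat
      using neg[unfolded not_ex, rule_format, of "1 / Suc n"] by (auto simp: not_less)
    then obtain b where b: "\<And>n. b n \<in> ball a (1 / Suc n)" "\<And>n. ereal c \<le> circle_mean V (b n) r"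
      by metis
    have "(\<lambda>n. dist (b n) a) \<longlonglongrightarrow> 0"
    proof (rule tendsto_sandwich[OF _ _ tendsto_const LIMSEQ_inverse_real_of_nat])
      show "\<forall>\<^sub>F n in sequentially. dist (b n) a \<le> inverse (real (Suc n))"
        using b(1) by (intro always_eventually allI) (simp add: dist_commute inverse_eq_divide less_imp_le)
    qed simp
    then have lim: "b \<longlonglongrightarrow> a" by (subst tendsto_dist_iff)
    have b1: "b n \<in> ball a 1" for n
    proof -
      have "1 / real (Suc n) \<le> 1" by simp
      then show ?thesis using b(1)[of n] by (meson mem_ball less_le_trans)
    qed
    have bd: "enn2ereal (circle_deficit V K (b n) r) \<le> ereal (2 * pi * (K - c))" for n
      using circle_mean_ge_iff[OF op K VK[OF b1], where c = c] b(2) by simp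
    then have "0 \<le> ereal (2 * pi * (K - c))" using enn2ereal_nonneg order_trans by blast
    then have c0: "0 \<le> 2 * pi * (K - c)" by simp
    have bd': "circle_deficit V K (b n) r \<le> ennreal (2 * pi * (K - c))" for n
      using bd[of n] c0 by (simp add: less_eq_ennreal.rep_eq enn2ereal_ennreal)
    have "circle_deficit V K a r \<le> liminf (\<lambda>n. circle_deficit V K (b n) r)"
      by (rule circle_deficit_Liminf[OF op lim])
    also have "\<dots> \<le> ennreal (2 * pi * (K - c))"
      by (rule Liminf_le) (use bd' in auto)
    finally have "ereal c \<le> circle_mean V a r"
      using circle_mean_ge_iff[OF op K VK[of a], where c = c] c0 by (simp add: less_eq_ennreal.rep_eq enn2ereal_ennreal)
    then show False using c by simp
  qed
  then obtain d where d: "d > 0" "\<And>b. b \<in> ball a d \<Longrightarrow> circle_mean V b r < ereal c" by auto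
  have "(SUP u\<in>F. u b) \<le> ereal c" if "b \<in> ball a d" for b
  proof (rule SUP_least)
    fix u assume u: "u \<in> F"
    have "u z \<le> V z" for z
      unfolding V_def using usc_reg_ge[of "\<lambda>z. SUP u\<in>F. u z" z] SUP_upper[OF u, of "\<lambda>u. u z"] by (rule order_trans[rotated])
    then have "circle_mean u b r \<le> circle_mean V b r" by (intro circle_mean_mono)
    moreover have "u b \<le> circle_mean u b r" using F[OF u] r by (simp add: subharmonic_def)
    ultimately show "u b \<le> ereal c" using d(2)[OF that] by simp
  qed
  then have "V a \<le> ereal c" unfolding V_def
    using d(1) by (intro usc_reg_le[of "ball a d"]) auto
  then show False using c(2) by simp
qed

section \<open>The equilibrium weight\<close>

definition admissible :: "(complex \<Rightarrow> real) \<Rightarrow> (complex \<Rightarrow> ereal) set" where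
  "admissible Q = {u. subharmonic u \<and> (\<forall>z. u z \<le> ereal (Q z)) \<and> log_growth u}"

definition superlogarithmic :: "(complex \<Rightarrow> real) \<Rightarrow> bool" where
  "superlogarithmic Q \<longleftrightarrow> (\<exists>\<epsilon>>0. \<exists>C\<^sub>0>0. \<forall>z. norm z \<ge> C\<^sub>0 \<longrightarrow> Q z \<ge> (1 + \<epsilon>) * ln ((norm z)\<^sup>2))"

lemma log_growthI:
  assumes "\<And>z. norm z \<ge> 1 \<Longrightarrow> ereal (ln ((norm z)\<^sup>2) - BL) \<le> u z"
    and "\<forall>\<^sub>F z in at_infinity. u z \<le> ereal (ln ((norm z)\<^sup>2) + BU)"
  shows "log_growth u"
  unfolding log_growth_def
proof (intro exI[of _ "max BL BU"])
  have "\<forall>\<^sub>F z::complex in at_infinity. norm z \<ge> 1"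
    unfolding eventually_at_infinity by auto
  with assms(2) show "\<forall>\<^sub>F z in at_infinity. ereal (ln ((norm z)\<^sup>2) - max BL BU) \<le> u z
      \<and> u z \<le> ereal (ln ((norm z)\<^sup>2) + max BL BU)"
  proof eventually_elim
    case (elim z)
    have "ereal (ln ((norm z)\<^sup>2) - max BL BU) \<le> ereal (ln ((norm z)\<^sup>2) - BL)"
      "ereal (ln ((norm z)\<^sup>2) + BU) \<le> ereal (ln ((norm z)\<^sup>2) + max BL BU)" by auto
    with elim assms(1)[of z] show ?case by (meson order_trans)
  qed
qed

lemma ln_norm_sq_le:
  fixes z b :: complex
  assumes "norm z \<ge> 1" "\<delta> > 0"
  shows "ln ((norm (z - b))\<^sup>2 + \<delta>) \<le> ln ((norm z)\<^sup>2) + ln ((1 + norm b)\<^sup>2 + \<delta>)"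
proof -
  have "norm (z - b) \<le> norm z + norm b" by (rule norm_triangle_ineq4)
  also have "\<dots> \<le> norm z * (1 + norm b)" using mult_right_mono[of 1 "norm z" "norm b"] assms by (simp add: distrib_left)
  finally have "(norm (z - b))\<^sup>2 \<le> (norm z)\<^sup>2 * (1 + norm b)\<^sup>2"
    by (metis norm_ge_zero power_mono power_mult_distrib)
  moreover have "1 * \<delta> \<le> (norm z)\<^sup>2 * \<delta>" using assms by (intro mult_right_mono) auto
  ultimately have "(norm (z - b))\<^sup>2 + \<delta> \<le> (norm z)\<^sup>2 * ((1 + norm b)\<^sup>2 + \<delta>)" by (simp add: distrib_left)
  moreover have pos: "(norm x)\<^sup>2 + \<delta> > 0" "(1 + norm b)\<^sup>2 + \<delta> > 0" for x :: complex
    using assms by (simp_all add: add_nonneg_pos)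
  ultimately have "ln ((norm (z - b))\<^sup>2 + \<delta>) \<le> ln ((norm z)\<^sup>2 * ((1 + norm b)\<^sup>2 + \<delta>))"
    using assms by (subst ln_le_cancel_iff) (auto intro!: mult_pos_pos)
  also have "\<dots> = ln ((norm z)\<^sup>2) + ln ((1 + norm b)\<^sup>2 + \<delta>)"
    using assms pos(2) by (subst ln_mult) auto
  finally show ?thesis .
qed

text \<open>Provides the basic competitor \<open>ln (|z|\<^sup>2 + 1) - B\<close>. It makes the family of competitors nonempty
  and, by taking maxima, supplies the lower growth bound for other competitors.\<close>

lemma log_weight_below:
  assumes Q: "continuous_on UNIV Q" and "superlogarithmic Q"
  obtains B where "\<And>z. ln ((norm z)\<^sup>2 + 1) - B \<le> Q z"
proof -
  obtain \<epsilon> C where \<epsilon>: "\<epsilon> > 0" "C > 0" "\<And>z. norm z \<ge> C \<Longrightarrow> (1 + \<epsilon>) * ln ((norm z)\<^sup>2) \<le> Q z"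
    using assms(2) by (auto simp: superlogarithmic_def)
  define R where "R = max C 1"
  have pos: "(norm z)\<^sup>2 + 1 > 0" for z :: complex by (simp add: add_nonneg_pos)
  have "continuous_on (cball 0 R) (\<lambda>z. Q z - ln ((norm z)\<^sup>2 + 1))"
    using pos by (intro continuous_intros continuous_on_subset[OF Q]) (auto simp: less_imp_neq[symmetric])
  then obtain B where B: "\<And>z. z \<in> cball 0 R \<Longrightarrow> \<bar>Q z - ln ((norm z)\<^sup>2 + 1)\<bar> \<le> B"
    using continuous_compact_abs_bound[OF _ compact_cball] by blast
  have "ln ((norm z)\<^sup>2 + 1) - max B (ln 2) \<le> Q z" for z
  proof (cases "norm z \<le> R")
    case True
    then have "\<bar>Q z - ln ((norm z)\<^sup>2 + 1)\<bar> \<le> B" using B by simp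
    then show ?thesis by linarith
  next
    case False
    then have z: "norm z \<ge> 1" "norm z \<ge> C" by (auto simp: R_def)
    have "ln ((norm z)\<^sup>2 + 1) \<le> ln ((norm z)\<^sup>2) + ln 2"
      using ln_norm_sq_le[of z 1 0] z by simp
    moreover have "ln ((norm z)\<^sup>2) \<le> (1 + \<epsilon>) * ln ((norm z)\<^sup>2)"
      using \<epsilon> z by (simp add: distrib_right)
    ultimately show ?thesis using \<epsilon>(3)[OF z(2)] by linarith
  qed
  then show ?thesis using that by blast
qed

lemma ln_le_ln_plus_one:
  assumes "norm (z::complex) \<ge> 1"
  shows "ln ((norm z)\<^sup>2) \<le> ln ((norm z)\<^sup>2 + 1)"
  using assms zero_le_power2[of "norm z"] by (subst ln_le_cancel_iff) (auto simp: add_nonneg_pos)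

lemma log_weight_admissible:
  assumes "\<And>z. ln ((norm z)\<^sup>2 + 1) - B \<le> Q z"
  shows "(\<lambda>z. ereal (ln ((norm z)\<^sup>2 + 1) - B)) \<in> admissible Q"
  unfolding admissible_def
proof (intro CollectI conjI allI)
  have "submean (\<lambda>z. ln ((norm (z - 0))\<^sup>2 + 1) + - B)"
    by (intro submean_add submean_ln submean_const) simp
  from submean_imp_subharmonic[OF this]
  show "subharmonic (\<lambda>z. ereal (ln ((norm z)\<^sup>2 + 1) - B))" by simp
  show "ereal (ln ((norm z)\<^sup>2 + 1) - B) \<le> ereal (Q z)" for z using assms by simp
  show "log_growth (\<lambda>z. ereal (ln ((norm z)\<^sup>2 + 1) - B))"
  proof (rule log_growthI[where BL = B and BU = "ln 2 - B"])
    show "ereal (ln ((norm z)\<^sup>2) - B) \<le> ereal (ln ((norm z)\<^sup>2 + 1) - B)" if "norm z \<ge> 1" for z :: complex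
      using ln_le_ln_plus_one[OF that] by simp
    have "\<forall>z::complex. norm z \<ge> 1 \<longrightarrow> ereal (ln ((norm z)\<^sup>2 + 1) - B) \<le> ereal (ln ((norm z)\<^sup>2) + (ln 2 - B))"
      using ln_norm_sq_le[of _ 1 0] by fastforce
    then show "\<forall>\<^sub>F z::complex in at_infinity. ereal (ln ((norm z)\<^sup>2 + 1) - B) \<le> ereal (ln ((norm z)\<^sup>2) + (ln 2 - B))"
      unfolding eventually_at_infinity by blast
  qed
qed

lemma unit_circle_bound:
  assumes Q: "continuous_on UNIV Q"
  obtains M :: real where "M \<ge> 0" "\<And>z::complex. norm z = 1 \<Longrightarrow> Q z \<le> M"
proof -
  obtain M where "M \<ge> 0" "\<And>z. z \<in> sphere 0 1 \<Longrightarrow> \<bar>Q z\<bar> \<le> M"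
    using continuous_compact_abs_bound[OF continuous_on_subset[OF Q] compact_sphere] by blast
  then show thesis using that[of M] by force
qed

text \<open>The regularized supremum \<open>V\<close> of all competitors is a competitor, hence the greatest one:
  continuity of \<open>Q\<close> gives \<open>V \<le> Q\<close>, and the exterior maximum principle bounds all competitors at
  infinity uniformly, by means of the maximum of \<open>Q\<close> on the unit circle.\<close>

lemma admissible_le_equilibrium:
  assumes Q: "continuous_on UNIV Q" and "superlogarithmic Q" and u: "u \<in> admissible Q"
  shows "u z \<le> ereal (equilibrium_weight Q z)"
proof -
  define V where "V = usc_reg (\<lambda>z. SUP u\<in>admissible Q. u z)"
  obtain B where B: "\<And>z. ln ((norm z)\<^sup>2 + 1) - B \<le> Q z"
    using log_weight_below[OF assms(1,2)] by blast
  note base = log_weight_admissible[OF B]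
  obtain M where M: "\<And>z::complex. norm z = 1 \<Longrightarrow> Q z \<le> M" using unit_circle_bound[OF Q] by blast
  have le_Q: "u z \<le> ereal (Q z)" if "u \<in> admissible Q" for u z
    using that by (simp add: admissible_def)
  have sub: "subharmonic u" if "u \<in> admissible Q" for u
    using that by (simp add: admissible_def)
  have le_V: "u z \<le> V z" if "u \<in> admissible Q" for u z
    unfolding V_def using usc_reg_ge[of "\<lambda>z. SUP u\<in>admissible Q. u z" z] SUP_upper[OF that, of "\<lambda>u. u z"]
    by (rule order_trans[rotated])
  have VQ: "V z \<le> ereal (Q z)" for z
    unfolding V_def by (rule usc_reg_le_continuous[of UNIV]) (auto intro: SUP_least le_Q Q)
  have ext: "u z \<le> ereal (M + ln ((norm z)\<^sup>2))" if u: "u \<in> admissible Q" and z: "norm z \<ge> 1" for u z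
  proof -
    obtain B' where "\<forall>\<^sub>F z in at_infinity. ereal (ln ((norm z)\<^sup>2) - B') \<le> u z \<and> u z \<le> ereal (ln ((norm z)\<^sup>2) + B')"
      using u unfolding admissible_def log_growth_def by blast
    then have "\<forall>\<^sub>F z in at_infinity. u z \<le> ereal (ln ((norm z)\<^sup>2) + B')"
      by (rule eventually_mono) simp
    moreover have "u z \<le> ereal M" if "norm z = 1" for z
      using le_Q[OF u, of z] M[OF that] by (meson ereal_less_eq(3) order_trans)
    ultimately show ?thesis using subharmonic_exterior_bound[OF sub[OF u]] z by blast
  qed
  have Vext: "V z \<le> ereal (M + ln ((norm z)\<^sup>2))" if "norm z > 1" for z
    unfolding V_def
  proof (rule usc_reg_le_continuous[of "{z. 1 < norm z}"])
    show "open {z::complex. 1 < norm z}" by (intro open_Collect_less continuous_intros)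
    show "continuous_on {z::complex. 1 < norm z} (\<lambda>z. M + ln ((norm z)\<^sup>2))"
      by (intro continuous_intros) auto
  qed (use that in \<open>auto intro!: SUP_least ext\<close>)
  have "V \<in> admissible Q"
    unfolding admissible_def
  proof (intro CollectI conjI allI VQ)
    show "subharmonic V"
      unfolding subharmonic_def
    proof (intro conjI allI impI)
      show "V z < \<infinity>" for z using VQ[of z] by (cases "V z") auto
      show "open {z. V z < c}" for c unfolding V_def by (rule usc_reg_less_open)
      show "V a \<le> circle_mean V a r" if "r > 0" for a r
        unfolding V_def using usc_reg_Sup_submean[where F = "admissible Q" and g = Q] sub Q le_Q that by blast
    qed
    have "\<forall>z. norm z \<ge> 2 \<longrightarrow> V z \<le> ereal (ln ((norm z)\<^sup>2) + M)"
      using Vext by (simp add: add.commute)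
    then have up: "\<forall>\<^sub>F z in at_infinity. V z \<le> ereal (ln ((norm z)\<^sup>2) + M)"
      unfolding eventually_at_infinity by blast
    have "ereal (ln ((norm z)\<^sup>2) - B) \<le> V z" if "norm z \<ge> 1" for z
    proof -
      have "ereal (ln ((norm z)\<^sup>2) - B) \<le> ereal (ln ((norm z)\<^sup>2 + 1) - B)" using ln_le_ln_plus_one[OF that] by simp
      also have "\<dots> \<le> V z" using le_V[OF base] .
      finally show ?thesis .
    qed
    from log_growthI[OF this up] show "log_growth V" .
  qed
  then have "(GREATEST u. u \<in> admissible Q) = V"
    by (intro Greatest_equality) (auto simp: le_fun_def intro: le_V)
  then have eq: "equilibrium_weight Q z = real_of_ereal (V z)"
    unfolding equilibrium_weight_def admissible_def by simp
  have "ereal (ln ((norm z)\<^sup>2 + 1) - B) \<le> V z" using le_V[OF base] .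
  then have "ereal (real_of_ereal (V z)) = V z"
    using VQ[of z] by (cases "V z") auto
  then show ?thesis using le_V[OF u] eq by simp
qed

text \<open>The competitor is the maximum of the basic one and \<open>v = m\<^sup>-\<^sup>1 ln (P\<^sub>\<delta> / 2A)\<close>, where \<open>P\<^sub>\<delta>\<close> arises from
  \<open>|p|\<^sup>2\<close> by replacing each factor \<open>|z - b|\<^sup>2\<close> with \<open>|z - b|\<^sup>2 + \<delta>\<close>. The parameter \<open>\<delta>\<close> depends on \<open>p\<close>, but at
  the expense of the factor 2 it leaves no trace in the result. On the disc of radius \<open>R\<close> the hypothesis
  gives \<open>v \<le> Q\<close>. Outside, the maximum principle gives \<open>v \<le> M + ln |z|\<^sup>2\<close> with \<open>M\<close> a bound for \<open>Q\<close> on the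
  unit circle, and \<open>R\<close> is chosen so large that the right-hand side is at most \<open>Q\<close>. So \<open>R\<close> depends
  on \<open>Q\<close> only.\<close>

lemma equilibrium_majorizes_polynomials:
  assumes Q: "continuous_on UNIV Q" and "superlogarithmic Q"
  obtains R where "R \<ge> 1" "\<And>m p A z. m > 0 \<Longrightarrow> real (degree p) \<le> m \<Longrightarrow> A > 0 \<Longrightarrow>
     (\<And>z. norm z \<le> R \<Longrightarrow> (norm (poly p z))\<^sup>2 \<le> A * exp (m * Q z)) \<Longrightarrow>
     (norm (poly p z))\<^sup>2 \<le> 2 * A * exp (m * equilibrium_weight Q z)"
proof -
  obtain \<epsilon> C where \<epsilon>: "\<epsilon> > 0" "C > 0" "\<And>z. norm z \<ge> C \<Longrightarrow> (1 + \<epsilon>) * ln ((norm z)\<^sup>2) \<le> Q z"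
    using assms(2) by (auto simp: superlogarithmic_def)
  obtain B where B: "\<And>z. ln ((norm z)\<^sup>2 + 1) - B \<le> Q z"
    using log_weight_below[OF assms] by blast
  obtain M where M: "M \<ge> 0" "\<And>z::complex. norm z = 1 \<Longrightarrow> Q z \<le> M" using unit_circle_bound[OF Q] by blast
  define R where "R = max (max C 1) (exp (M / \<epsilon>))"
  have R: "R \<ge> C" "R \<ge> 1" "R \<ge> exp (M / \<epsilon>)" by (auto simp: R_def)
  have far: "M + ln ((norm z)\<^sup>2) \<le> Q z" if z: "norm z \<ge> R" for z
  proof -
    have z1: "norm z \<ge> 1" "norm z \<ge> C" using z R by auto
    have "exp (M / \<epsilon>) \<le> norm z" using z R by simp
    then have "M / \<epsilon> \<le> ln (norm z)" using z1 by (subst ln_ge_iff) auto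
    also have "\<dots> \<le> ln ((norm z)\<^sup>2)" using z1 by (simp add: ln_realpow)
    finally have "M \<le> \<epsilon> * ln ((norm z)\<^sup>2)" using \<epsilon> by (simp add: field_simps)
    then show ?thesis using \<epsilon>(3)[OF z1(2)] by (simp add: distrib_right)
  qed
  have "(norm (poly p z0))\<^sup>2 \<le> 2 * A * exp (m * equilibrium_weight Q z0)"
    if m: "m > 0" and deg: "real (degree p) \<le> m" and A: "A > 0"
      and bound: "\<And>z. norm z \<le> R \<Longrightarrow> (norm (poly p z))\<^sup>2 \<le> A * exp (m * Q z)" for m p A z0
  proof (cases "p = 0")
    case True
    then show ?thesis using A by simp
  next
    case False
    define k where "k = degree p"
    obtain b where b: "smult (lead_coeff p) (\<Prod>i<k. [:- b i, 1:]) = p"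
      using complex_poly_decompose'[of p] unfolding k_def by blast
    define l where "l = (norm (lead_coeff p))\<^sup>2"
    have l: "l > 0" using False by (simp add: l_def)
    define P where "P = (\<lambda>\<delta> z. l * (\<Prod>i<k. (norm (z - b i))\<^sup>2 + \<delta>))"
    have P0: "P 0 z = (norm (poly p z))\<^sup>2" for z
      by (subst b[symmetric]) (simp add: P_def l_def poly_prod norm_mult prod_norm[symmetric] power_mult_distrib prod_power_distrib)
    obtain q where q: "\<And>z. z \<in> cball 0 R \<Longrightarrow> \<bar>Q z\<bar> \<le> q"
      using continuous_compact_abs_bound[OF continuous_on_subset[OF Q] compact_cball] by blast
    have q0: "- q \<le> Q z" if "z \<in> cball 0 R" for z using q[OF that] by linarith
    define \<eta> where "\<eta> = A * exp (m * - q)"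
    have \<eta>: "\<eta> > 0" using A by (simp add: \<eta>_def)
    have "uniformly_continuous_on ({0..1} \<times> cball 0 R) (\<lambda>x. P (fst x) (snd x))"
      unfolding P_def by (intro compact_uniformly_continuous continuous_intros compact_Times) auto
    then obtain d where d: "d > 0" "\<And>x x'. x \<in> {0..1} \<times> cball 0 R \<Longrightarrow> x' \<in> {0..1} \<times> cball 0 R \<Longrightarrow> dist x' x < d
        \<Longrightarrow> dist (P (fst x') (snd x')) (P (fst x) (snd x)) < \<eta>"
      using \<eta> by (rule uniformly_continuous_onE) blast
    define \<delta> where "\<delta> = min 1 (d / 2)"
    have \<delta>: "\<delta> > 0" "\<delta> \<le> 1" "\<delta> < d" using d(1) by (auto simp: \<delta>_def)
    have P\<delta>: "P \<delta> z \<le> 2 * A * exp (m * Q z)" if "norm z \<le> R" for z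
    proof -
      have "dist (P \<delta> z) (P 0 z) < \<eta>"
        using d(2)[of "(0, z)" "(\<delta>, z)"] that \<delta> by (simp add: dist_Pair_Pair)
      then have "P \<delta> z \<le> (norm (poly p z))\<^sup>2 + \<eta>" unfolding P0 dist_real_def by linarith
      also have "\<dots> \<le> A * exp (m * Q z) + A * exp (m * Q z)"
      proof -
        have "m * - q \<le> m * Q z" using q0[of z] that m by (intro mult_left_mono) auto
        then have "exp (m * - q) \<le> exp (m * Q z)" by simp
        then show ?thesis
          using bound[OF that] A unfolding \<eta>_def by (intro add_mono mult_left_mono) auto
      qed
      finally show ?thesis by simp
    qed
    have fpos: "(norm (z - b i))\<^sup>2 + \<delta> > 0" for z i using \<delta> by (simp add: add_nonneg_pos)
    then have Ppos: "P \<delta> z > 0" for z using l by (auto simp: P_def intro!: mult_pos_pos prod_pos)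
    define v where "v = (\<lambda>z. (1 / m) * (ln l - ln (2 * A) + (\<Sum>i<k. ln ((norm (z - b i))\<^sup>2 + \<delta>))))"
    have mv: "m * v z = ln (P \<delta> z) - ln (2 * A)" for z
    proof -
      have "ln (\<Prod>i<k. (norm (z - b i))\<^sup>2 + \<delta>) = (\<Sum>i<k. ln ((norm (z - b i))\<^sup>2 + \<delta>))"
        using fpos by (intro ln_prod) (auto simp: less_imp_neq[symmetric])
      moreover have "ln (P \<delta> z) = ln l + ln (\<Prod>i<k. (norm (z - b i))\<^sup>2 + \<delta>)"
        unfolding P_def by (intro ln_mult_pos l prod_pos fpos)
      moreover have "m * v z = ln l - ln (2 * A) + (\<Sum>i<k. ln ((norm (z - b i))\<^sup>2 + \<delta>))"
        using m by (simp add: v_def)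
      ultimately show ?thesis by linarith
    qed
    have Pv: "P \<delta> z = 2 * A * exp (m * v z)" for z
      unfolding mv using Ppos A by (simp add: exp_diff)
    have v_sub: "submean v"
      unfolding v_def using m \<delta> by (intro submean_scale submean_add submean_const submean_sum submean_ln) auto
    have v_near: "v z \<le> Q z" if "norm z \<le> R" for z
      using P\<delta>[OF that] A m unfolding Pv by simp
    define c where "c = (\<Sum>i<k. ln ((1 + norm (b i))\<^sup>2 + \<delta>))"
    define B' where "B' = (1 / m) * (ln l - ln (2 * A) + c)"
    have v_growth: "v z \<le> ln ((norm z)\<^sup>2) + B'" if "norm z \<ge> 1" for z
    proof -
      have "(\<Sum>i<k. ln ((norm (z - b i))\<^sup>2 + \<delta>)) \<le> (\<Sum>i<k. ln ((norm z)\<^sup>2) + ln ((1 + norm (b i))\<^sup>2 + \<delta>))"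
        by (intro sum_mono ln_norm_sq_le that \<delta>)
      also have "\<dots> = real k * ln ((norm z)\<^sup>2) + c" by (simp add: c_def sum.distrib)
      also have "\<dots> \<le> m * ln ((norm z)\<^sup>2) + c"
        using deg that by (intro add_mono mult_right_mono) (auto simp: k_def)
      finally have "m * v z \<le> m * (ln ((norm z)\<^sup>2) + B')"
        using m by (simp add: v_def B'_def distrib_left)
      then show ?thesis using m by simp
    qed
    then have v_growth': "\<forall>\<^sub>F z in at_infinity. ereal (v z) \<le> ereal (ln ((norm z)\<^sup>2) + B')"
      unfolding eventually_at_infinity by (intro exI[of _ 1]) simp
    have v_far: "v z \<le> Q z" if "norm z \<ge> R" for z
    proof -
      have "ereal (v z) \<le> ereal (M + ln ((norm z)\<^sup>2))"
      proof (rule subharmonic_exterior_bound[OF submean_imp_subharmonic[OF v_sub] v_growth'])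
        show "ereal (v z) \<le> ereal M" if "norm z = 1" for z
          using v_near[of z] M(2)[OF that] that R by simp
        show "1 \<le> norm z" using that R by simp
      qed
      then show ?thesis using far[OF that] by simp
    qed
    have vQ: "v z \<le> Q z" for z using v_near v_far by (meson linear)
    define u where "u = (\<lambda>z. max (v z) (ln ((norm z)\<^sup>2 + 1) - B))"
    have "(\<lambda>z. ereal (u z)) \<in> admissible Q"
      unfolding admissible_def
    proof (intro CollectI conjI allI)
      have "submean (\<lambda>z. max (v z) (ln ((norm (z - 0))\<^sup>2 + 1) + - B))"
        by (intro submean_max v_sub submean_add submean_ln submean_const) simp
      from submean_imp_subharmonic[OF this] show "subharmonic (\<lambda>z. ereal (u z))" by (simp add: u_def)
      show "ereal (u z) \<le> ereal (Q z)" for z using vQ B by (simp add: u_def)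
      have up: "u z \<le> ln ((norm z)\<^sup>2) + max B' (ln 2 - B)" if "norm z \<ge> 1" for z
        using v_growth[OF that] ln_norm_sq_le[of z 1 0] that by (simp add: u_def max_def)
      show "log_growth (\<lambda>z. ereal (u z))"
      proof (rule log_growthI[where BL = B and BU = "max B' (ln 2 - B)"])
        show "ereal (ln ((norm z)\<^sup>2) - B) \<le> ereal (u z)" if "norm z \<ge> 1" for z
          using ln_le_ln_plus_one[OF that] by (simp add: u_def le_max_iff_disj)
        show "\<forall>\<^sub>F z in at_infinity. ereal (u z) \<le> ereal (ln ((norm z)\<^sup>2) + max B' (ln 2 - B))"
          unfolding eventually_at_infinity by (intro exI[of _ 1]) (use up in simp)
      qed
    qed
    from admissible_le_equilibrium[OF assms this, of z0]
    have "v z0 \<le> equilibrium_weight Q z0" by (simp add: u_def)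
    then have "P \<delta> z0 \<le> 2 * A * exp (m * equilibrium_weight Q z0)"
      unfolding Pv using A m by simp
    moreover have "P 0 z0 \<le> P \<delta> z0"
      unfolding P_def using l \<delta> by (intro mult_left_mono prod_mono) auto
    ultimately show ?thesis by (simp add: P0)
  qed
  then show thesis using that R(2) by blast
qed

section \<open>Taylor expansion of the weight\<close>

lemma C2_smooth_continuous: "C2_smooth Q \<Longrightarrow> continuous_on UNIV Q"
  unfolding C2_smooth_def by (meson continuous_at_imp_continuous_on has_derivative_continuous)

lemma C2_smooth_Taylor:
  assumes "C2_smooth Q"
  obtains M where "M \<ge> 0" "\<And>a. norm a \<le> R \<Longrightarrow> \<exists>l. \<forall>z. norm (z - a) \<le> 1 \<longrightarrow>
      Q z \<le> Q a + Re (l * (z - a)) + M * (norm (z - a))\<^sup>2"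
proof -
  obtain Q' :: "complex \<Rightarrow> (complex \<Rightarrow>\<^sub>L real)" and Q'' :: "complex \<Rightarrow> (complex \<Rightarrow>\<^sub>L (complex \<Rightarrow>\<^sub>L real))"
    where Q': "\<And>z. (Q has_derivative blinfun_apply (Q' z)) (at z)"
      and Q'': "\<And>z. (Q' has_derivative blinfun_apply (Q'' z)) (at z)" "continuous_on UNIV Q''"
    using assms unfolding C2_smooth_def by blast
  have "continuous_on (cball 0 (R + 1)) (\<lambda>z. norm (Q'' z))"
    by (intro continuous_intros continuous_on_subset[OF Q''(2)]) auto
  then obtain M where M: "M \<ge> 0" "\<And>z. z \<in> cball 0 (R + 1) \<Longrightarrow> \<bar>norm (Q'' z)\<bar> \<le> M"
    using continuous_compact_abs_bound[OF _ compact_cball] by blast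
  have lip: "norm (Q' x - Q' y) \<le> M * norm (x - y)" if "x \<in> cball 0 (R + 1)" "y \<in> cball 0 (R + 1)" for x y
  proof (rule differentiable_bound[OF convex_cball _ _ that])
    show "(Q' has_derivative blinfun_apply (Q'' w)) (at w within cball 0 (R + 1))" for w
      using Q''(1) by (rule has_derivative_at_withinI)
    show "onorm (blinfun_apply (Q'' w)) \<le> M" if "w \<in> cball 0 (R + 1)" for w
      using M(2)[OF that] by (simp add: norm_blinfun.rep_eq)
  qed
  have "\<exists>l. \<forall>z. norm (z - a) \<le> 1 \<longrightarrow> Q z \<le> Q a + Re (l * (z - a)) + M * (norm (z - a))\<^sup>2"
    if a: "norm a \<le> R" for a
  proof (intro exI allI impI)
    fix z assume z: "norm (z - a) \<le> 1"
    define r where "r = norm (z - a)"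
    define g where "g = (\<lambda>w. Q w - Q' a w)"
    have sub: "w \<in> cball 0 (R + 1)" if "w \<in> cball a r" for w
    proof -
      have "norm w \<le> norm a + norm (w - a)" by (rule norm_triangle_sub)
      also have "\<dots> \<le> R + 1" using that z a by (simp add: r_def dist_norm norm_minus_commute)
      finally show ?thesis by simp
    qed
    have "norm (g z - g a) \<le> (M * r) * norm (z - a)"
    proof (rule differentiable_bound[OF convex_cball[of a r]])
      fix w assume w: "w \<in> cball a r"
      show "(g has_derivative blinfun_apply (Q' w - Q' a)) (at w within cball a r)"
        unfolding g_def
        by (auto simp: blinfun.diff_left intro!: derivative_eq_intros has_derivative_at_withinI[OF Q'])
      have "onorm (blinfun_apply (Q' w - Q' a)) = norm (Q' w - Q' a)" by (simp add: norm_blinfun.rep_eq)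
      also have "\<dots> \<le> M * norm (w - a)" using sub[OF w] a by (intro lip) auto
      also have "\<dots> \<le> M * r" using w M(1) by (intro mult_left_mono) (auto simp: dist_norm norm_minus_commute)
      finally show "onorm (blinfun_apply (Q' w - Q' a)) \<le> M * r" .
    qed (auto simp: r_def dist_norm norm_minus_commute)
    then have "Q z \<le> Q a + (Q' a z - Q' a a) + M * r\<^sup>2"
      by (simp add: g_def r_def power2_eq_square)
    also have "Q' a z - Q' a a = Re (Complex (Q' a 1) (- (Q' a \<i>)) * (z - a))"
    proof -
      define w where "w = z - a"
      have "Q' a w = Q' a (Re w *\<^sub>R 1 + Im w *\<^sub>R \<i>)"
        by (rule arg_cong[where f = "blinfun_apply (Q' a)"]) (simp add: complex_eq_iff)
      also have "\<dots> = Re w * Q' a 1 + Im w * Q' a \<i>"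
        by (simp add: blinfun.add_right blinfun.scaleR_right)
      finally show ?thesis by (simp add: w_def[symmetric] blinfun.diff_right[symmetric] algebra_simps)
    qed
    finally show "Q z \<le> Q a + Re (Complex (Q' a 1) (- (Q' a \<i>)) * (z - a)) + M * (norm (z - a))\<^sup>2"
      by (simp add: r_def)
  qed
  then show thesis using that M(1) by blast
qed

section \<open>Orthonormal bases and reproducing kernels\<close>

lemma L2_inner_self: "L2_inner M f f = of_real (\<integral>x. (norm (f x))\<^sup>2 \<partial>M)"
  unfolding L2_inner_def by (simp add: complex_norm_square[symmetric] del: of_real_power)

lemma L2_inner_add_mult:
  assumes "f \<in> L2_space M" "g \<in> L2_space M" "h \<in> L2_space M"
  shows "L2_inner M (\<lambda>z. a * f z + c * g z) h = a * L2_inner M f h + c * L2_inner M g h"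
proof -
  have "L2_inner M (\<lambda>z. a * f z + c * g z) h = (\<integral>z. a * (f z * cnj (h z)) + c * (g z * cnj (h z)) \<partial>M)"
    unfolding L2_inner_def by (intro Bochner_Integration.integral_cong refl) (simp add: algebra_simps)
  also have "\<dots> = a * L2_inner M f h + c * L2_inner M g h"
    unfolding L2_inner_def by (simp add: L2_mult_integrable assms)
  finally show ?thesis .
qed

lemma L2_inner_sum:
  assumes "\<And>j. j \<in> J \<Longrightarrow> e j \<in> L2_space M" "h \<in> L2_space M"
  shows "L2_inner M (\<lambda>z. \<Sum>j\<in>J. c j * e j z) h = (\<Sum>j\<in>J. c j * L2_inner M (e j) h)"
proof -
  have "L2_inner M (\<lambda>z. \<Sum>j\<in>J. c j * e j z) h = (\<integral>z. (\<Sum>j\<in>J. c j * (e j z * cnj (h z))) \<partial>M)"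
    unfolding L2_inner_def
    by (intro Bochner_Integration.integral_cong refl) (simp add: sum_distrib_right mult.assoc)
  also have "\<dots> = (\<Sum>j\<in>J. c j * L2_inner M (e j) h)"
    unfolding L2_inner_def by (subst Bochner_Integration.integral_sum) (auto simp: L2_mult_integrable assms)
  finally show ?thesis .
qed

text \<open>Induction on the number of spanning functions. The functions in \<open>V\<close> whose expansion omits the
  last spanning function form a subspace \<open>V'\<close> of codimension at most one; one Gram-Schmidt step
  extends an orthonormal basis of \<open>V'\<close>.\<close>

lemma orthonormal_basis_exists:
  fixes b :: "nat \<Rightarrow> 'a \<Rightarrow> complex"
  assumes "(\<lambda>_. 0) \<in> V"
    and "\<And>f g a c. f \<in> V \<Longrightarrow> g \<in> V \<Longrightarrow> (\<lambda>z. a * f z + c * g z) \<in> V"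
    and "V \<subseteq> L2_space M"
    and "\<And>f. f \<in> V \<Longrightarrow> L2_inner M f f = 0 \<Longrightarrow> f = (\<lambda>_. 0)"
    and "\<And>f. f \<in> V \<Longrightarrow> \<exists>c. f = (\<lambda>z. \<Sum>j<k. c j * b j z)"
  shows "\<exists>(d::nat) e. V = {f. \<exists>c. f = (\<lambda>z. \<Sum>j<d. c j * e j z)} \<and>
    (\<forall>i<d. \<forall>j<d. L2_inner M (e i) (e j) = (if i = j then 1 else 0))"
  using assms
proof (induction k arbitrary: V)
  case 0
  have "f = (\<lambda>_. 0)" if "f \<in> V" for f using "0.prems"(5)[OF that] by simp
  then have "V = {\<lambda>_. 0}" using "0.prems"(1) by blast
  then show ?case by (intro exI[of _ 0]) auto
next
  case (Suc k)
  note zero = Suc.prems(1) and lin = Suc.prems(2) and L2 = Suc.prems(3)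
    and definite = Suc.prems(4) and span = Suc.prems(5)
  define V' where "V' = {f \<in> V. \<exists>c. f = (\<lambda>z. \<Sum>j<k. c j * b j z)}"
  have "\<exists>(d::nat) e. V' = {f. \<exists>c. f = (\<lambda>z. \<Sum>j<d. c j * e j z)} \<and>
    (\<forall>i<d. \<forall>j<d. L2_inner M (e i) (e j) = (if i = j then 1 else 0))"
  proof (rule Suc.IH)
    show "(\<lambda>_. 0) \<in> V'" using zero by (auto simp: V'_def intro!: exI[of _ "\<lambda>_. 0"])
    show "(\<lambda>z. p * f z + q * g z) \<in> V'" if "f \<in> V'" "g \<in> V'" for f g p q
    proof -
      from that obtain c c' where "f = (\<lambda>z. \<Sum>j<k. c j * b j z)" "g = (\<lambda>z. \<Sum>j<k. c' j * b j z)"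
        by (auto simp: V'_def)
      then have "(\<lambda>z. p * f z + q * g z) = (\<lambda>z. \<Sum>j<k. (p * c j + q * c' j) * b j z)"
        by (auto simp: sum_distrib_left sum.distrib algebra_simps)
      moreover have "(\<lambda>z. p * f z + q * g z) \<in> V" using that lin by (simp add: V'_def)
      ultimately show ?thesis
        unfolding V'_def by (intro CollectI conjI exI[of _ "\<lambda>j. p * c j + q * c' j"])
    qed
    show "V' \<subseteq> L2_space M" using L2 by (auto simp: V'_def)
    show "f = (\<lambda>_. 0)" if "f \<in> V'" "L2_inner M f f = 0" for f
      using definite that by (auto simp: V'_def)
    show "\<exists>c. f = (\<lambda>z. \<Sum>j<k. c j * b j z)" if "f \<in> V'" for f using that by (auto simp: V'_def)
  qed
  then obtain d :: nat and e where V': "V' = {f. \<exists>c. f = (\<lambda>z. \<Sum>j<d. c j * e j z)}"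
    and on: "\<And>i j. i < d \<Longrightarrow> j < d \<Longrightarrow> L2_inner M (e i) (e j) = (if i = j then 1 else 0)" by blast
  have eV: "e i \<in> V'" if "i < d" for i
    unfolding V' using that
    by (intro CollectI exI[of _ "\<lambda>j. if j = i then 1 else 0"]) (auto simp: if_distrib[of "\<lambda>x. x * _"] cong: if_cong)
  have eV2: "e i \<in> V" and eL2: "e i \<in> L2_space M" if "i < d" for i
    using eV[OF that] L2 by (auto simp: V'_def)
  show ?case
  proof (cases "V = V'")
    case True
    then show ?thesis using V' on by blast
  next
    case False
    then obtain f where f: "f \<in> V" "f \<notin> V'" by (auto simp: V'_def)
    obtain c0 where c0: "f = (\<lambda>z. \<Sum>j<Suc k. c0 j * b j z)" using span[OF f(1)] by blast
    have c00: "c0 k \<noteq> 0"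
    proof
      assume "c0 k = 0"
      then have "f = (\<lambda>z. \<Sum>j<k. c0 j * b j z)" by (simp add: c0)
      then show False using f by (auto simp: V'_def)
    qed
    have decomp: "\<exists>q. (\<lambda>z. g z - q * f z) \<in> V'" if g: "g \<in> V" for g
    proof -
      obtain c where c: "g = (\<lambda>z. \<Sum>j<Suc k. c j * b j z)" using span[OF g] by blast
      define q where "q = c k / c0 k"
      have "(\<lambda>z. g z - q * f z) = (\<lambda>z. \<Sum>j<k. (c j - q * c0 j) * b j z)"
        using c00 by (simp add: c c0 q_def distrib_left sum_distrib_left sum_subtractf left_diff_distrib mult.assoc fun_eq_iff)
      moreover have "(\<lambda>z. g z - q * f z) \<in> V" using lin[OF g f(1), of 1 "-q"] by simp
      ultimately have "(\<lambda>z. g z - q * f z) \<in> V'"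
        unfolding V'_def by (intro CollectI conjI exI[of _ "\<lambda>j. c j - q * c0 j"])
      then show ?thesis ..
    qed
    define Pf where "Pf = (\<lambda>z. \<Sum>j<d. L2_inner M f (e j) * e j z)"
    have PfV': "Pf \<in> V'" 
    unfolding V' Pf_def by (rule CollectI, rule exI[of _ "\<lambda>j. L2_inner M f (e j)"], rule refl)
    then have PfV: "Pf \<in> V" by (simp add: V'_def)
    define f' where "f' = (\<lambda>z. f z - Pf z)"
    have f'V: "f' \<in> V" using lin[OF f(1) PfV, of 1 "-1"] by (simp add: f'_def)
    have f'n0: "f' \<noteq> (\<lambda>_. 0)"
    proof
      assume "f' = (\<lambda>_. 0)"
      then have "f = Pf" by (auto simp: f'_def fun_eq_iff)
      then show False using f PfV' by simp
    qed
    have fL2: "f \<in> L2_space M" "Pf \<in> L2_space M" "f' \<in> L2_space M" using f PfV f'V L2 by auto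
    have orth: "L2_inner M f' (e i) = 0" if i: "i < d" for i
    proof -
      have "L2_inner M f' (e i) = 1 * L2_inner M f (e i) + (-1) * L2_inner M Pf (e i)"
        using L2_inner_add_mult[OF fL2(1,2) eL2[OF i], of 1 "-1"] by (simp add: f'_def)
      also have "L2_inner M Pf (e i) = (\<Sum>j<d. L2_inner M f (e j) * L2_inner M (e j) (e i))"
        unfolding Pf_def using eL2 i by (intro L2_inner_sum) auto
      also have "\<dots> = (\<Sum>j<d. if j = i then L2_inner M f (e j) else 0)"
        using on i by (intro sum.cong) auto
      also have "\<dots> = L2_inner M f (e i)" using i by simp
      finally show ?thesis by simp
    qed
    define N where "N = (\<integral>x. (norm (f' x))\<^sup>2 \<partial>M)"
    have N: "L2_inner M f' f' = of_real N" by (simp add: N_def L2_inner_self)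
    have "N \<ge> 0" unfolding N_def by simp
    moreover have "N \<noteq> 0" using definite[OF f'V] f'n0 N by auto
    ultimately have N0: "N > 0" by simp
    define s where "s = sqrt N"
    have s: "s > 0" "s * s = N" using N0 by (auto simp: s_def)
    define e' where "e' = (\<lambda>j. if j < d then e j else (\<lambda>z. f' z / of_real s))"
    have scale: "L2_inner M (\<lambda>z. f' z / of_real s) h = L2_inner M f' h / of_real s" for h
      unfolding L2_inner_def by simp
    have on': "L2_inner M (e' i) (e' j) = (if i = j then 1 else 0)" if "i < Suc d" "j < Suc d" for i j
    proof -
      consider "i < d" "j < d" | "i = d" "j < d" | "i < d" "j = d" | "i = d" "j = d"
        using \<open>i < Suc d\<close> \<open>j < Suc d\<close> by linarith
      then show ?thesis
      proof cases
        case 3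
        have "L2_inner M (e i) (\<lambda>z. f' z / of_real s) = cnj (L2_inner M (\<lambda>z. f' z / of_real s) (e i))"
          by (rule L2_inner_commute)
        then show ?thesis using 3 orth by (simp add: e'_def scale)
      next
        case 4
        have "L2_inner M f' (\<lambda>z. f' z / of_real s) = cnj (L2_inner M (\<lambda>z. f' z / of_real s) f')"
          by (rule L2_inner_commute)
        also have "\<dots> = of_real N / of_real s" by (simp add: scale N)
        finally show ?thesis using 4 s N0 by (simp add: e'_def scale of_real_mult[symmetric] del: of_real_mult)
      qed (use on orth in \<open>auto simp: e'_def scale\<close>)
    qed
    have e'V: "e' j \<in> V" if "j < Suc d" for j
      using that eV2 lin[OF f'V zero, of "1 / of_real s" 0] by (auto simp: e'_def)
    have sumV: "(\<lambda>z. \<Sum>j<l. c j * e' j z) \<in> V" if "l \<le> Suc d" for c l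
      using that
    proof (induction l)
      case (Suc l)
      then show ?case using lin[OF Suc.IH e'V[of l], of 1 "c l"] by (simp add: add.commute)
    qed (use zero in auto)
    have "V = {g. \<exists>c. g = (\<lambda>z. \<Sum>j<Suc d. c j * e' j z)}"
    proof (intro set_eqI iffI)
      fix g assume "g \<in> V"
      from decomp[OF this] obtain q where "(\<lambda>z. g z - q * f z) \<in> V'" by blast
      then obtain c where c: "(\<lambda>z. g z - q * f z) = (\<lambda>z. \<Sum>j<d. c j * e j z)" unfolding V' by blast
      define c' where "c' = (\<lambda>j. if j < d then c j + q * L2_inner M f (e j) else q * of_real s)"
      have "g z = (\<Sum>j<Suc d. c' j * e' j z)" for z
      proof -
        have "g z = (\<Sum>j<d. c j * e j z) + q * f z" using fun_cong[OF c, of z] by (simp add: algebra_simps)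
        also have "f z = Pf z + f' z" by (simp add: f'_def)
        also have "(\<Sum>j<d. c j * e j z) + q * (Pf z + f' z) = (\<Sum>j<d. (c j + q * L2_inner M f (e j)) * e j z) + q * f' z"
          by (simp add: Pf_def sum_distrib_left sum.distrib algebra_simps)
        finally show ?thesis using s by (simp add: c'_def e'_def)
      qed
      then show "g \<in> {g. \<exists>c. g = (\<lambda>z. \<Sum>j<Suc d. c j * e' j z)}" by blast
    next
      fix g assume "g \<in> {g. \<exists>c. g = (\<lambda>z. \<Sum>j<Suc d. c j * e' j z)}"
      then obtain c where "g = (\<lambda>z. \<Sum>j<Suc d. c j * e' j z)" by blast
      with sumV[OF le_refl, of c] show "g \<in> V" by (simp only:)
    qed
    with on' show ?thesis by blast
  qed
qed

text \<open>The function \<open>F\<^sub>w = K(\<cdot>, w)\<close> satisfies \<open>\<parallel>F\<^sub>w\<parallel>\<^sup>2 = K(w, w) = S(w)\<close>. Applying the evaluation bound to \<open>F\<^sub>w\<close>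
  at \<open>w\<close> gives \<open>S \<le> A\<close>, and applying it to \<open>F\<^sub>z\<close> at \<open>w\<close> then gives the claim.\<close>

lemma reproducing_kernel_bound:
  fixes b :: "nat \<Rightarrow> 'a \<Rightarrow> complex"
  assumes zero: "(\<lambda>_. 0) \<in> V"
    and lin: "\<And>f g a c. f \<in> V \<Longrightarrow> g \<in> V \<Longrightarrow> (\<lambda>z. a * f z + c * g z) \<in> V"
    and L2: "V \<subseteq> L2_space M"
    and span: "\<And>f. f \<in> V \<Longrightarrow> \<exists>c. f = (\<lambda>z. \<Sum>j<k. c j * b j z)"
    and eval: "\<And>f z. f \<in> V \<Longrightarrow> (norm (f z))\<^sup>2 \<le> A z * (\<integral>x. (norm (f x))\<^sup>2 \<partial>M)"
    and A: "\<And>z. A z \<ge> 0"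
  shows "(norm (reproducing_kernel M V w z))\<^sup>2 \<le> A w * A z"
proof -
  have definite: "f = (\<lambda>_. 0)" if "f \<in> V" "L2_inner M f f = 0" for f
    using eval[OF that(1)] that(2) by (auto simp: L2_inner_self fun_eq_iff)
  obtain d :: nat and e where V: "V = {f. \<exists>c. f = (\<lambda>z. \<Sum>j<d. c j * e j z)}"
    and on: "\<forall>i<d. \<forall>j<d. L2_inner M (e i) (e j) = (if i = j then 1 else 0)"
    using orthonormal_basis_exists[OF zero lin L2 definite span] by blast
  have K: "reproducing_kernel M V = (\<lambda>z w. \<Sum>j<d. e j z * cnj (e j w))"
    by (rule reproducing_kernel_orthonormal_basis[OF _ L2 V]) (use on in auto)
  have eV: "e i \<in> V" if "i < d" for i
    unfolding V using that
    by (intro CollectI exI[of _ "\<lambda>j. if j = i then 1 else 0"]) (auto simp: if_distrib[of "\<lambda>x. x * _"] cong: if_cong)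
  then have eL2: "e i \<in> L2_space M" if "i < d" for i using L2 that by auto
  define S where "S = (\<lambda>w. \<Sum>j<d. (norm (e j w))\<^sup>2)"
  define F where "F = (\<lambda>w z. \<Sum>j<d. cnj (e j w) * e j z)"
  have FV: "F w \<in> V" for w
    unfolding V F_def by (rule CollectI, rule exI[of _ "\<lambda>j. cnj (e j w)"], rule refl)
  have FK: "reproducing_kernel M V z w = F w z" for z w by (simp add: K F_def mult.commute)
  have Fe: "L2_inner M (e i) (F w) = e i w" if i: "i < d" for i w
  proof -
    have "L2_inner M (e i) (F w) = cnj (L2_inner M (F w) (e i))" by (rule L2_inner_commute)
    also have "L2_inner M (F w) (e i) = (\<Sum>j<d. cnj (e j w) * L2_inner M (e j) (e i))"
      unfolding F_def using eL2 i by (intro L2_inner_sum) auto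
    also have "\<dots> = (\<Sum>j<d. if j = i then cnj (e j w) else 0)"
      using on i by (intro sum.cong) auto
    also have "\<dots> = cnj (e i w)" using i by simp
    finally show ?thesis by simp
  qed
  have "L2_inner M (F w) (F w) = of_real (S w)" for w
  proof -
    have "L2_inner M (\<lambda>z. \<Sum>j<d. cnj (e j w) * e j z) (F w) = (\<Sum>j<d. cnj (e j w) * L2_inner M (e j) (F w))"
      by (rule L2_inner_sum) (use eL2 FV L2 in auto)
    moreover have "(\<lambda>z. \<Sum>j<d. cnj (e j w) * e j z) = F w" by (simp only: F_def)
    ultimately have "L2_inner M (F w) (F w) = (\<Sum>j<d. cnj (e j w) * L2_inner M (e j) (F w))" by simp
    also have "\<dots> = (\<Sum>j<d. of_real ((norm (e j w))\<^sup>2))"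
      by (intro sum.cong refl) (simp add: Fe complex_norm_square mult.commute del: of_real_power)
    finally show ?thesis by (simp add: S_def)
  qed
  then have N: "(\<integral>x. (norm (F w x))\<^sup>2 \<partial>M) = S w" for w
    unfolding L2_inner_self of_real_eq_iff .
  have S0: "S w \<ge> 0" for w by (simp add: S_def sum_nonneg)
  have Fd: "F w w = of_real (S w)" for w
    unfolding F_def S_def of_real_sum
    by (intro sum.cong refl) (simp add: complex_norm_square mult.commute del: of_real_power)
  have SA: "S w \<le> A w" for w
  proof (cases "S w = 0")
    case False
    have "(norm (F w w))\<^sup>2 \<le> A w * S w" using eval[OF FV, of w w] by (simp add: N)
    then have "S w * S w \<le> A w * S w" by (simp add: Fd power2_eq_square)
    then show ?thesis using False S0[of w] by simp
  qed (use A in simp)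
  have "(norm (F z w))\<^sup>2 \<le> A w * S z" using eval[OF FV, of z w] by (simp add: N)
  also have "\<dots> \<le> A w * A z" by (intro mult_left_mono SA A)
  finally show ?thesis by (simp add: FK)
qed

section \<open>The kernel of the polyanalytic polynomials\<close>

lemma Pol_2_polys:
  assumes "f \<in> Pol 2 n"
  obtains g h where "degree g \<le> n - 1" "degree h \<le> n - 1" "\<And>z. f z = poly g z + cnj z * poly h z"
proof -
  from assms obtain c where c: "f = (\<lambda>z. \<Sum>r<2. \<Sum>j<n. c r j * (cnj z ^ r * z ^ j))"
    by (auto simp: Pol_def)
  define G where "G = (\<lambda>r. \<Sum>j<n. monom (c r j) j)"
  have deg: "degree (G r) \<le> n - 1" for r
    unfolding G_def
    by (rule degree_sum_le) (auto intro: order_trans[OF degree_monom_le])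
  have "f z = poly (G 0) z + cnj z * poly (G 1) z" for z
    by (simp add: c G_def poly_sum poly_monom numeral_2_eq_2 sum_distrib_left mult_ac)
  then show thesis using that deg by blast
qed

lemma polynomial_holomorphic: "poly p holomorphic_on A"
  for p :: "complex poly"
  by (intro holomorphic_intros)

text \<open>Freezing the conjugate variable at \<open>z0\<close> turns \<open>f\<close> into a polynomial \<open>p\<close> with \<open>p(z0) = f(z0)\<close> which on
  the disc of radius \<open>R\<close> is controlled by \<open>|f|\<close> and \<open>|h|\<close>. For \<open>|z0| > 1\<close> the factor \<open>z / z0\<close> compensates
  the growth of \<open>|z - z0|\<close> in \<open>z0\<close>; it raises the degree to \<open>n\<close>, which is still at most \<open>m\<close>.\<close>

lemma polyanalytic_point_evaluation:
  assumes C2: "C2_smooth Q" and "superlogarithmic Q"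
  obtains C where "C \<ge> 0" "\<And>m n f z. m \<ge> 1 \<Longrightarrow> n \<ge> 1 \<Longrightarrow> real n \<le> m \<Longrightarrow> f \<in> polyanalytic_space 2 m Q n \<Longrightarrow>
    (norm (f z))\<^sup>2 \<le> C * m\<^sup>2 * exp (m * equilibrium_weight Q z) * (\<integral>x. (norm (f x))\<^sup>2 \<partial>weighted_area m Q)"
proof -
  have Q: "continuous_on UNIV Q" by (rule C2_smooth_continuous[OF C2])
  obtain R where R: "R \<ge> 1" "\<And>m p A z. m > 0 \<Longrightarrow> real (degree p) \<le> m \<Longrightarrow> A > 0 \<Longrightarrow>
     (\<And>z. norm z \<le> R \<Longrightarrow> (norm (poly p z))\<^sup>2 \<le> A * exp (m * Q z)) \<Longrightarrow>
     (norm (poly p z))\<^sup>2 \<le> 2 * A * exp (m * equilibrium_weight Q z)"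
    using equilibrium_majorizes_polynomials[OF Q assms(2)] by blast
  obtain M where M: "M \<ge> 0" "\<And>a. norm a \<le> R \<Longrightarrow> \<exists>l. \<forall>z. norm (z - a) \<le> 1 \<longrightarrow>
      Q z \<le> Q a + Re (l * (z - a)) + M * (norm (z - a))\<^sup>2"
    using C2_smooth_Taylor[OF C2] by blast
  define D where "D = 4096 * pi * exp M"
  define E where "E = R\<^sup>2 * (2 * (1 + (R + 1)\<^sup>2)) * D"
  have D: "D > 0" by (simp add: D_def)
  have E: "E > 0" using D R(1) by (auto simp: E_def intro!: mult_pos_pos add_pos_nonneg)
  have "(norm (f z0))\<^sup>2 \<le> (2 * E) * m\<^sup>2 * exp (m * equilibrium_weight Q z0) * (\<integral>x. (norm (f x))\<^sup>2 \<partial>weighted_area m Q)"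
    if m: "m \<ge> 1" and n: "n \<ge> 1" "real n \<le> m" and f: "f \<in> polyanalytic_space 2 m Q n" for m n f z0
  proof -
    from f have fL2: "f \<in> L2_space (weighted_area m Q)" and "f \<in> Pol 2 n" by (auto simp: polyanalytic_space_def)
    then obtain g h where deg: "degree g \<le> n - 1" "degree h \<le> n - 1"
      and gh: "\<And>z. f z = poly g z + cnj z * poly h z" using Pol_2_polys by blast
    define N where "N = (\<integral>x. (norm (f x))\<^sup>2 \<partial>weighted_area m Q)"
    have N0: "N \<ge> 0" by (simp add: N_def)
    have int: "integrable (weighted_area m Q) (\<lambda>z. (norm (poly g z + cnj z * poly h z))\<^sup>2)"
      using fL2 by (simp add: L2_space_def gh)
    have m0: "m > 0" using m by simp
    have m2: "m \<le> m\<^sup>2" using m by (simp add: power2_eq_square)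
    have loc: "(norm (f z))\<^sup>2 \<le> D * m\<^sup>2 * exp (m * Q z) * N" "(norm (poly h z))\<^sup>2 \<le> D * m\<^sup>2 * exp (m * Q z) * N"
      if z: "norm z \<le> R" for z
    proof -
      obtain l where l: "\<And>w. norm (w - z) \<le> 1 \<Longrightarrow> Q w \<le> Q z + Re (l * (w - z)) + M * (norm (w - z))\<^sup>2"
        using M(2)[OF z] by blast
      have l': "Q w \<le> Q z + Re (l * (w - z)) + M * (norm (w - z))\<^sup>2" if "norm (w - z) \<le> 1 / sqrt m" for w
      proof (rule l)
        have "1 / sqrt m \<le> 1" using m by simp
        with that show "norm (w - z) \<le> 1" by linarith
      qed
      note est = bianalytic_weighted_estimate[OF polynomial_holomorphic polynomial_holomorphic Q m0 l' M(1) int]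
      have "(norm (f z))\<^sup>2 \<le> D * m * exp (m * Q z) * N"
        using est(1) by (simp add: D_def N_def gh)
      also have "\<dots> \<le> D * m\<^sup>2 * exp (m * Q z) * N"
        using m2 D N0 by (intro mult_right_mono mult_left_mono) auto
      finally show "(norm (f z))\<^sup>2 \<le> D * m\<^sup>2 * exp (m * Q z) * N" .
      show "(norm (poly h z))\<^sup>2 \<le> D * m\<^sup>2 * exp (m * Q z) * N"
        using est(2) by (simp add: D_def N_def gh)
    qed
    define p0 where "p0 = g + smult (cnj z0) h"
    define p where "p = (if norm z0 \<le> 1 then p0 else smult (1 / z0) (pCons 0 p0))"
    have deg0: "degree p0 \<le> n - 1"
      unfolding p0_def using deg by (intro degree_add_le) (auto intro: order_trans[OF degree_smult_le])
    have "degree p \<le> n"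
    proof -
      have "degree (pCons 0 p0) \<le> n" using deg0 n degree_pCons_le[of 0 p0] by simp
      then have "degree (smult (1 / z0) (pCons 0 p0)) \<le> n" by (rule order_trans[OF degree_smult_le])
      moreover have "degree p0 \<le> n" using deg0 by simp
      ultimately show ?thesis unfolding p_def by simp
    qed
    then have degp: "real (degree p) \<le> m" using n by simp
    have p0_eq: "poly p0 z = f z - (cnj z - cnj z0) * poly h z" for z
      by (simp add: p0_def gh algebra_simps)
    have pz0: "poly p z0 = f z0" by (auto simp: p_def p0_eq)
    have p_le: "norm (poly p z) \<le> R * (norm (f z) + (R + 1) * norm (poly h z))" if z: "norm z \<le> R" for z
    proof -
      have n0: "norm (poly p0 z) \<le> norm (f z) + (R + norm z0) * norm (poly h z)"
      proof -
        have "norm (poly p0 z) \<le> norm (f z) + norm (cnj z - cnj z0) * norm (poly h z)"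
          unfolding p0_eq norm_mult[symmetric] by (rule norm_triangle_ineq4)
        also have "norm (cnj z - cnj z0) \<le> R + norm z0"
          using norm_triangle_ineq4[of "cnj z" "cnj z0"] z by simp
        finally show ?thesis by (simp add: mult_right_mono)
      qed
      show ?thesis
      proof (cases "norm z0 \<le> 1")
        case True
        have "norm (poly p z) \<le> norm (f z) + (R + norm z0) * norm (poly h z)" using n0 True by (simp add: p_def)
        also have "\<dots> \<le> 1 * (norm (f z) + (R + 1) * norm (poly h z))"
          using True by (simp add: mult_right_mono)
        also have "\<dots> \<le> R * (norm (f z) + (R + 1) * norm (poly h z))"
          using R(1) by (intro mult_right_mono) auto
        finally show ?thesis .
      next
        case False
        define t where "t = norm z0"
        have t: "t > 1" using False by (simp add: t_def)
        have "norm (poly p z) = norm z * (norm (poly p0 z) / t)"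
          using False by (simp add: p_def norm_mult norm_divide t_def)
        also have "\<dots> \<le> R * (norm (poly p0 z) / t)"
          using z t by (intro mult_right_mono) auto
        also have "norm (poly p0 z) / t \<le> norm (f z) + (R + 1) * norm (poly h z)"
        proof -
          have "norm (poly p0 z) \<le> norm (f z) + (R + t) * norm (poly h z)" using n0 by (simp add: t_def)
          also have "\<dots> \<le> t * norm (f z) + (t * (R + 1)) * norm (poly h z)"
          proof (intro add_mono mult_right_mono)
            show "norm (f z) \<le> t * norm (f z)" using t mult_right_mono[of 1 t "norm (f z)"] by simp
            show "R + t \<le> t * (R + 1)" using t R(1) mult_right_mono[of 1 t R] by (simp add: distrib_left)
          qed simp
          also have "\<dots> = (norm (f z) + (R + 1) * norm (poly h z)) * t" by (simp add: algebra_simps)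
          finally show ?thesis using t by (simp add: pos_divide_le_eq)
        qed
        finally show ?thesis using R(1) by (simp add: mult_left_mono)
      qed
    qed
    have p_sq: "(norm (poly p z))\<^sup>2 \<le> E * m\<^sup>2 * exp (m * Q z) * N" if z: "norm z \<le> R" for z
    proof -
      define x where "x = norm (f z)"
      define y where "y = norm (poly h z)"
      have "(norm (poly p z))\<^sup>2 \<le> (R * (x + (R + 1) * y))\<^sup>2"
        using p_le[OF z] by (intro power_mono) (auto simp: x_def y_def)
      also have "\<dots> = R\<^sup>2 * (x + (R + 1) * y)\<^sup>2" by (simp add: power_mult_distrib)
      also have "\<dots> \<le> R\<^sup>2 * (2 * x\<^sup>2 + 2 * ((R + 1) * y)\<^sup>2)"
      proof (intro mult_left_mono)
        have "0 \<le> (x - (R + 1) * y)\<^sup>2" by simp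
        then show "(x + (R + 1) * y)\<^sup>2 \<le> 2 * x\<^sup>2 + 2 * ((R + 1) * y)\<^sup>2"
          unfolding power2_sum power2_diff by linarith
      qed simp
      also have "\<dots> = R\<^sup>2 * (2 * x\<^sup>2 + 2 * (R + 1)\<^sup>2 * y\<^sup>2)" by (simp add: power_mult_distrib)
      also have "\<dots> \<le> R\<^sup>2 * (2 * (D * m\<^sup>2 * exp (m * Q z) * N) + 2 * (R + 1)\<^sup>2 * (D * m\<^sup>2 * exp (m * Q z) * N))"
        using loc[OF z] unfolding x_def y_def by (intro mult_left_mono add_mono) auto
      also have "\<dots> = E * m\<^sup>2 * exp (m * Q z) * N" by (simp add: E_def algebra_simps)
      finally show ?thesis .
    qed
    define k where "k = 2 * E * m\<^sup>2 * exp (m * equilibrium_weight Q z0)"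
    have k: "k > 0" using E m by (simp add: k_def)
    \<comment> \<open>The term \<open>e\<close> covers the case \<open>N = 0\<close>, where the majorization by the equilibrium weight needs
      a positive constant.\<close>
    have "(norm (f z0))\<^sup>2 \<le> k * N + e" if e: "e > 0" for e
    proof -
      have "(norm (poly p z0))\<^sup>2 \<le> 2 * (E * m\<^sup>2 * (N + e / k)) * exp (m * equilibrium_weight Q z0)"
      proof (rule R(2)[OF m0 degp])
        show "0 < E * m\<^sup>2 * (N + e / k)" using E m N0 e k by (intro mult_pos_pos add_nonneg_pos) auto
        fix z :: complex assume "norm z \<le> R"
        from p_sq[OF this] have "(norm (poly p z))\<^sup>2 \<le> E * m\<^sup>2 * exp (m * Q z) * N" .
        also have "\<dots> \<le> E * m\<^sup>2 * exp (m * Q z) * (N + e / k)" using E e k by (intro mult_left_mono) auto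
        finally show "(norm (poly p z))\<^sup>2 \<le> E * m\<^sup>2 * (N + e / k) * exp (m * Q z)" by (simp add: mult_ac)
      qed
      also have "\<dots> = k * (N + e / k)" by (simp add: k_def)
      also have "\<dots> = k * N + e" using k by (simp add: distrib_left)
      finally show ?thesis by (simp add: pz0)
    qed
    then have "(norm (f z0))\<^sup>2 \<le> k * N" by (rule field_le_epsilon)
    then show ?thesis by (simp add: k_def N_def)
  qed
  moreover have "2 * E \<ge> 0" using E by simp
  ultimately show thesis using that by blast
qed

lemma polyanalytic_space_closed:
  shows "(\<lambda>_. 0) \<in> polyanalytic_space q m Q n"
    and "f \<in> polyanalytic_space q m Q n \<Longrightarrow> g \<in> polyanalytic_space q m Q n \<Longrightarrow>
      (\<lambda>z. a * f z + c * g z) \<in> polyanalytic_space q m Q n"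
proof -
  show "(\<lambda>_. 0) \<in> polyanalytic_space q m Q n"
    by (auto simp: polyanalytic_space_def L2_space_def Pol_def intro!: exI[of _ "\<lambda>_ _. 0"])
  assume f: "f \<in> polyanalytic_space q m Q n" and g: "g \<in> polyanalytic_space q m Q n"
  then obtain c1 c2 where
    "f = (\<lambda>z. \<Sum>r<q. \<Sum>j<n. c1 r j * (cnj z ^ r * z ^ j))" "g = (\<lambda>z. \<Sum>r<q. \<Sum>j<n. c2 r j * (cnj z ^ r * z ^ j))"
    by (auto simp: polyanalytic_space_def Pol_def)
  then have "(\<lambda>z. a * f z + c * g z) = (\<lambda>z. \<Sum>r<q. \<Sum>j<n. (a * c1 r j + c * c2 r j) * (cnj z ^ r * z ^ j))"
    by (simp add: sum_distrib_left sum.distrib distrib_right mult.assoc)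
  then have "(\<lambda>z. a * f z + c * g z) \<in> Pol q n"
    unfolding Pol_def by (intro CollectI exI[of _ "\<lambda>r j. a * c1 r j + c * c2 r j"])
  moreover have "(\<lambda>z. a * f z + c * g z) \<in> L2_space (weighted_area m Q)"
  proof -
    let ?M = "weighted_area m Q"
    have [measurable]: "f \<in> borel_measurable ?M" "g \<in> borel_measurable ?M"
      and int: "integrable ?M (\<lambda>x. (norm (f x))\<^sup>2)" "integrable ?M (\<lambda>x. (norm (g x))\<^sup>2)"
      using f g by (auto simp: polyanalytic_space_def L2_space_def)
    have "integrable ?M (\<lambda>x. (norm (a * f x + c * g x))\<^sup>2)"
    proof (rule Bochner_Integration.integrable_bound)
      show "integrable ?M (\<lambda>x. 2 * (norm a)\<^sup>2 * (norm (f x))\<^sup>2 + 2 * (norm c)\<^sup>2 * (norm (g x))\<^sup>2)"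
        using int by (intro Bochner_Integration.integrable_add integrable_mult_right)
      have "(norm (a * f x + c * g x))\<^sup>2 \<le> 2 * (norm a)\<^sup>2 * (norm (f x))\<^sup>2 + 2 * (norm c)\<^sup>2 * (norm (g x))\<^sup>2" for x
      proof -
        have "(norm (a * f x + c * g x))\<^sup>2 \<le> (norm (a * f x) + norm (c * g x))\<^sup>2"
          by (intro power_mono norm_triangle_ineq) simp
        also have "\<dots> \<le> 2 * (norm (a * f x))\<^sup>2 + 2 * (norm (c * g x))\<^sup>2"
          using zero_le_power2[of "norm (a * f x) - norm (c * g x)"] unfolding power2_sum power2_diff by linarith
        finally show ?thesis by (simp add: norm_mult power_mult_distrib)
      qed
      then show "AE x in ?M. norm ((norm (a * f x + c * g x))\<^sup>2) \<le> norm (2 * (norm a)\<^sup>2 * (norm (f x))\<^sup>2 + 2 * (norm c)\<^sup>2 * (norm (g x))\<^sup>2)"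
        by (intro AE_I2) (simp add: abs_of_nonneg)
    qed measurable
    then show ?thesis by (simp add: L2_space_def)
  qed
  ultimately show "(\<lambda>z. a * f z + c * g z) \<in> polyanalytic_space q m Q n" by (simp add: polyanalytic_space_def)
qed

text \<open>Enumerates the double sum by a single index, quotient and remainder modulo \<open>n\<close>.\<close>

lemma Pol_span:
  assumes "f \<in> Pol q n" 
  shows "\<exists>c. f = (\<lambda>z. \<Sum>i<q * n. c i * (cnj z ^ (i div n) * z ^ (i mod n)))"
proof (cases "n = 0")
  case True
  then show ?thesis using assms by (auto simp: Pol_def)
next
  case False
  from assms obtain c where c: "f = (\<lambda>z. \<Sum>r<q. \<Sum>j<n. c r j * (cnj z ^ r * z ^ j))"
    by (auto simp: Pol_def)
  have index: "r * n + j < q * n" if "r < q" "j < n" for r j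
  proof -
    have "r * n + j < Suc r * n" using that by simp
    also have "\<dots> \<le> q * n" using that by (intro mult_le_mono1) simp
    finally show ?thesis .
  qed
  have "f z = (\<Sum>i<q * n. c (i div n) (i mod n) * (cnj z ^ (i div n) * z ^ (i mod n)))" for z
  proof -
    have "f z = (\<Sum>(r, j)\<in>{..<q} \<times> {..<n}. c r j * (cnj z ^ r * z ^ j))"
      by (simp add: c sum.cartesian_product)
    also have "\<dots> = (\<Sum>i<q * n. c (i div n) (i mod n) * (cnj z ^ (i div n) * z ^ (i mod n)))"
      by (rule sum.reindex_bij_witness[of _ "\<lambda>i. (i div n, i mod n)" "\<lambda>(r, j). r * n + j"])
        (use False in \<open>auto simp: less_mult_imp_div_less index\<close>)
    finally show ?thesis .
  qed
  then show ?thesis by (intro exI[of _ "\<lambda>i. c (i div n) (i mod n)"]) (rule ext)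
qed

theorem mainTheorem4:
  fixes Q :: "complex \<Rightarrow> real"
  assumes "C2_smooth Q"
    and "\<exists>\<epsilon>>0. \<exists>C\<^sub>0>0. \<forall>z. norm z \<ge> C\<^sub>0 \<longrightarrow> Q z \<ge> (1 + \<epsilon>) * ln ((norm z)\<^sup>2)"
  shows "\<exists>C::real. \<forall>(z::complex) (w::complex) (m::real) (n::nat).
    m \<ge> 1 \<longrightarrow> n \<ge> 1 \<longrightarrow> real n \<le> m \<longrightarrow>
      (norm (polyanalytic_kernel 2 m Q n w z))\<^sup>2 * exp (- m * Q w - m * Q z)
        \<le> C\<^sup>2 * m ^ 4 * exp (- m * (Q z - equilibrium_weight Q z))
            * exp (- m * (Q w - equilibrium_weight Q w))"
proof -
  have "superlogarithmic Q" using assms(2) by (simp add: superlogarithmic_def)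
  then obtain C where C: "C \<ge> 0" "\<And>m n f z. m \<ge> 1 \<Longrightarrow> n \<ge> 1 \<Longrightarrow> real n \<le> m \<Longrightarrow> f \<in> polyanalytic_space 2 m Q n \<Longrightarrow>
    (norm (f z))\<^sup>2 \<le> C * m\<^sup>2 * exp (m * equilibrium_weight Q z) * (\<integral>x. (norm (f x))\<^sup>2 \<partial>weighted_area m Q)"
    using polyanalytic_point_evaluation[OF assms(1)] by blast
  show ?thesis
  proof (intro exI[of _ C] allI impI)
    fix z w :: complex and m :: real and n :: nat
    assume m: "m \<ge> 1" "n \<ge> 1" "real n \<le> m"
    define A where "A = (\<lambda>z. C * m\<^sup>2 * exp (m * equilibrium_weight Q z))"
    have "(norm (polyanalytic_kernel 2 m Q n w z))\<^sup>2 \<le> A w * A z"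
      unfolding polyanalytic_kernel_def
    proof (rule reproducing_kernel_bound[OF polyanalytic_space_closed])
      show "polyanalytic_space 2 m Q n \<subseteq> L2_space (weighted_area m Q)"
        by (auto simp: polyanalytic_space_def)
      show "\<exists>c. f = (\<lambda>z. \<Sum>i<2 * n. c i * (cnj z ^ (i div n) * z ^ (i mod n)))"
        if "f \<in> polyanalytic_space 2 m Q n" for f
        using that by (intro Pol_span) (simp add: polyanalytic_space_def)
      show "A z \<ge> 0" for z using C(1) by (simp add: A_def)
    qed (use C(2)[OF m] in \<open>auto simp: A_def\<close>)
    then have "(norm (polyanalytic_kernel 2 m Q n w z))\<^sup>2 * exp (- m * Q w - m * Q z)
        \<le> A w * A z * exp (- m * Q w - m * Q z)"
      by (intro mult_right_mono) auto
    also have "\<dots> = C\<^sup>2 * m ^ 4 * (exp (m * equilibrium_weight Q w) * exp (m * equilibrium_weight Q z) * exp (- m * Q w - m * Q z))"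
      by (simp add: A_def power2_eq_square power4_eq_xxxx mult_ac)
    also have "exp (m * equilibrium_weight Q w) * exp (m * equilibrium_weight Q z) * exp (- m * Q w - m * Q z)
      = exp (- m * (Q z - equilibrium_weight Q z)) * exp (- m * (Q w - equilibrium_weight Q w))"
      by (simp add: exp_add[symmetric] algebra_simps)
    finally show "(norm (polyanalytic_kernel 2 m Q n w z))\<^sup>2 * exp (- m * Q w - m * Q z)
        \<le> C\<^sup>2 * m ^ 4 * exp (- m * (Q z - equilibrium_weight Q z)) * exp (- m * (Q w - equilibrium_weight Q w))"
      by (simp add: mult.assoc)
  qed
qed

end
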